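(* Consider a hierarchical convex game $\mathscr{G}$ with $\mathbf{N}$ players where, for any $i\in\{1,\dots,\mathbf{N}\}$, $f_i(\cdot,\mathbf{x}^{-i})$ is a convex function for any $\mathbf{x}^{-i}\in\mathcal{X}_{-i}$ and $\mathcal{X}_i\subseteq\mathbb{R}^{n_i}$ is a closed and convex set. Let $\eta>0$ and let $\mathscr{G}_\eta$ be the $\eta$-smoothed game with objectives $f_{i,\eta}$; suppose $\mathscr{G}_\eta$ is a potential game with potential function $P_\eta$ satisfying $P_\eta(\mathbf{x})\ge\tilde P_\eta$ for any $\mathbf{x}\in\mathcal{X}+\eta\mathbb{B}$, where $\tilde P_\eta\in\mathbb{R}$. Let $B_{i,\eta}$ be the smoothed proximal best-response maps with proximal parameter $c>0$, and let $\{\mathbf{x}^k\}$ be generated by the scheme (ARSPBR) described in the context, with constants $L$ and $M_i$ as in the context. Then the following hold for any $i\in\{1,\dots,\mathbf{N}\}$: (a) For $k\ge0$, the following holds almost surely: $$\mathbb{E}[P_\eta(\mathbf{x}^{k+1})-\tilde P_\eta\mid\mathcal{F}_k]\le(P_\eta(\mathbf{x}^k)-\tilde P_\eta)-\gamma_k\left(c-\tfrac{L\gamma_k}{2}\right)\|B_{i,\eta}(\mathbf{x}^k)-\mathbf{x}^{i,k}\|^2+\sum_{j=1}^{\mathbf{N}}M_j\,\mathbb{E}[\|\epsilon^{j,k+1}\|\mid\mathcal{F}_k].$$ (b) Suppose one of the following holds: (i) $\{\gamma_k\}$ is a decreasing, non-summable but square-summable sequence with $\gamma_k<\tfrac{2c}{L}$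 for every $k$; (ii) $\gamma_k=1$ for every $k$ and $c>\tfrac L2$. Furthermore, suppose $\sum_{k=0}^\infty\sum_{j=1}^{\mathbf{N}}M_j\,\mathbb{E}[\|\epsilon^{j,k+1}\|\mid\mathcal{F}_k]<\infty$ almost surely. Then $\lim_{k\to\infty}\sum_{j=1}^{\mathbf{N}}\|\mathbf{x}^{j,k}-B_{j,\eta}(\mathbf{x}^k)\|^2=0$ almost surely. (c) Suppose $\lim_{k\to\infty}\sum_{j=1}^{\mathbf{N}}\|\mathbf{x}^{j,k}-B_{j,\eta}(\mathbf{x}^k)\|^2=0$ almost surely. Then $\{\mathbf{x}^k\}$ converges to the set of Nash equilibria of $\mathscr{G}_\eta$ almost surely.
   Context: Game $\mathscr{G}$: player $i$ minimizes $f_i(\cdot,\mathbf{x}^{-i})$ over $\mathcal{X}_i$; $\mathcal{X}=\prod_i\mathcal{X}_i$, $\mathcal{X}_{-i}=\prod_{j\ne i}\mathcal{X}_j$. Here $f_i(\mathbf{x}^i,\mathbf{x}^{-i})=\mathbb{E}[\tilde f_i(\mathbf{x}^i,\mathbf{y}^i(\mathbf{x},\omega),\mathbf{x}^{-i},\omega)]$ with $\mathbf{y}^i(\mathbf{x},\omega)$ the unique solution of a lower-level variational inequality $\mathrm{VI}(\mathcal{Y}_i,F_i(\cdot,\mathbf{x},\omega))$ with $F_i(\cdot,\mathbf{x},\omega)$ strongly monotone. Smoothing: $f_{i,\eta}(\mathbf{x}^i,\mathbf{x}^{-i})=\mathbb{E}_{u_i}[f_i(\mathbf{x}^i+\eta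 u_i,\mathbf{x}^{-i})]$ with $u_i$ uniform on the unit ball $\mathbb{B}_i\subset\mathbb{R}^{n_i}$; $\mathbb{B}=\prod_i\mathbb{B}_i$. $\mathscr{G}_\eta$: player $i$ minimizes $f_{i,\eta}(\cdot,\mathbf{x}^{-i})$ over $\mathcal{X}_i$. $P_\eta$ is a potential for $\mathscr{G}_\eta$ if $P_\eta(\mathbf{x}^i,\mathbf{x}^{-i})-P_\eta(\mathbf{z}^i,\mathbf{x}^{-i})=f_{i,\eta}(\mathbf{x}^i,\mathbf{x}^{-i})-f_{i,\eta}(\mathbf{z}^i,\mathbf{x}^{-i})$ for all $i$, $\mathbf{x}^i,\mathbf{z}^i\in\mathcal{X}_i$, $\mathbf{x}^{-i}\in\mathcal{X}_{-i}$. Standing assumption: subgradients in $\partial_{\mathbf{x}^i}f_i(\mathbf{x}^i,\mathbf{x}^{-i})$ are uniformly bounded over $\mathbf{x}\in\mathcal{X}$. Standing facts/constants: $f_{i,\eta}(\cdot,\mathbf{x}^{-i})$ is convex and differentiable with $L$-Lipschitz gradient for every $\mathbf{x}^{-i}$, where $L=\bar\alpha/\eta$ for a constant $\bar\alpha>0$; $M_i$ is a uniform bound on $\|\nabla_{\mathbf{x}^i}f_{i,\eta}(\cdot)\|$. Smoothed proximal best response: $B_{i,\eta}(\mathbf{x})=\operatorname{argmin}_{\mathbf{v}^i\in\mathcal{X}_i}[f_{i,\eta}(\mathbf{v}^i,\mathbf{x}^{-i})+\tfrac c2\|\mathbf{v}^i-\mathbf{x}^i\|^2]$. Scheme (ARSPBR,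 asynchronous relaxed smoothed proximal best-response): given $\mathbf{x}^0\in\mathcal{X}$, probabilities $p_i\in(0,1)$ with $\sum_ip_i=1$, and relaxation weights $\{\gamma_k\}$, at iteration $k$ a player $i_k$ is drawn (independently of the past) with $\mathbb{P}(i_k=i)=p_i$. For $i=i_k$: $\mathbf{z}^{i,k+1}=(1-\gamma_k)\mathbf{x}^{i,k}+\gamma_kB_{i,\eta}(\mathbf{x}^k)$ and $\mathbf{x}^{i,k+1}=\mathbf{z}^{i,k+1}+\epsilon^{i,k+1}$, where $\epsilon^{i,k+1}$ is the random error from inexact computation of the best response. For $i\ne i_k$: $\mathbf{x}^{i,k+1}=\mathbf{z}^{i,k+1}=\mathbf{x}^{i,k}$ and $\epsilon^{i,k+1}=0$. $\mathcal{F}_k$ is the $\sigma$-algebra generated by $\mathbf{x}^0$, the players selected, and the samples used before iteration $k$, so that $\mathbf{x}^k$ is $\mathcal{F}_k$-measurable.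
   Formalization: In (a) the inequality is shown for the selected player i=i_k given F_k and i_k, and p_i-averaged given F_k; all x^k and z^k are assumed to lie in X; in (c) all cluster points are Nash equilibria, and the distance to the equilibrium set tends to 0 on bounded trajectories. *)

theory Defs
  imports "HOL-Probability.Probability"
begin

text \<open>
  A strategy profile of the players \<open>i :: 'p\<close> is a vector \<open>x :: real ^ 'd\<close>; the map \<open>own :: 'd \<Rightarrow> 'p\<close>
  tells which player controls which coordinate.  The strategy space of player \<open>i\<close>, of dimension
  \<open>n_i = card {d. own d = i}\<close>, is the coordinate subspace \<open>stratspace own i\<close>.  Since \<open>own\<close> is an
  arbitrary surjection, every number of players and every family of dimensions \<open>n_i \<ge> 1\<close> occurs,
  and norms and inner products are those of \<open>real ^ 'd\<close>.
\<close>

definition stratspace :: "('d::finite \<Rightarrow> 'p) \<Rightarrow> 'p \<Rightarrow> (real ^ 'd) set" where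
  "stratspace own i = {v. \<forall>d. own d \<noteq> i \<longrightarrow> v $ d = 0}"

definition block :: "('d::finite \<Rightarrow> 'p) \<Rightarrow> 'p \<Rightarrow> real ^ 'd \<Rightarrow> real ^ 'd" where
  "block own i x = (\<chi> d. if own d = i then x $ d else 0)"

text \<open>\<open>repl own i v x\<close> is the profile \<open>(v, x\<^sup>-\<^sup>i)\<close>.\<close>

definition repl :: "('d::finite \<Rightarrow> 'p) \<Rightarrow> 'p \<Rightarrow> real ^ 'd \<Rightarrow> real ^ 'd \<Rightarrow> real ^ 'd" where
  "repl own i v x = (\<chi> d. if own d = i then v $ d else x $ d)"

definition profiles :: "('d::finite \<Rightarrow> 'p) \<Rightarrow> ('p \<Rightarrow> (real ^ 'd) set) \<Rightarrow> (real ^ 'd) set" where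
  "profiles own X = {x. \<forall>i. block own i x \<in> X i}"

text \<open>The profiles \<open>x\<close> with \<open>x\<^sup>-\<^sup>i\<close> feasible; the block of player \<open>i\<close> itself is unrestricted.\<close>

definition rivals_feasible ::
    "('d::finite \<Rightarrow> 'p) \<Rightarrow> ('p \<Rightarrow> (real ^ 'd) set) \<Rightarrow> 'p \<Rightarrow> (real ^ 'd) set" where
  "rivals_feasible own X i = {x. \<forall>j. j \<noteq> i \<longrightarrow> block own j x \<in> X j}"

definition ball_product :: "('d::finite \<Rightarrow> 'p) \<Rightarrow> (real ^ 'd) set" where
  "ball_product own = {u. \<forall>i. norm (block own i u) \<le> 1}"

text \<open>
  The lower-level variables of different players may share one space \<open>'y\<close>: only the values of the
  maps on the sets \<open>Y i\<close> matter, so lower-dimensional problems embed by padding with zeros.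
\<close>

definition VI_solutions :: "'y::real_inner set \<Rightarrow> ('y \<Rightarrow> 'y) \<Rightarrow> 'y set" where
  "VI_solutions Y F = {y \<in> Y. \<forall>z\<in>Y. 0 \<le> F y \<bullet> (z - y)}"

definition strongly_monotone_on :: "'y::real_inner set \<Rightarrow> ('y \<Rightarrow> 'y) \<Rightarrow> bool" where
  "strongly_monotone_on Y F \<longleftrightarrow>
     (\<exists>\<mu>>0. \<forall>y\<in>Y. \<forall>z\<in>Y. \<mu> * (norm (y - z))\<^sup>2 \<le> (F y - F z) \<bullet> (y - z))"

definition lower_response ::
    "('p \<Rightarrow> 'y::real_inner set) \<Rightarrow> ('p \<Rightarrow> 'y \<Rightarrow> 'x \<Rightarrow> 'o \<Rightarrow> 'y) \<Rightarrow> 'p \<Rightarrow> 'x \<Rightarrow> 'o \<Rightarrow> 'y" where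
  "lower_response Y F i x \<omega> = (THE y. y \<in> VI_solutions (Y i) (\<lambda>y. F i y x \<omega>))"

text \<open>\<open>ft i x y \<omega>\<close> takes the whole profile \<open>x = (x\<^sup>i, x\<^sup>-\<^sup>i)\<close> as a single argument.\<close>

definition objective ::
    "'o measure \<Rightarrow> ('p \<Rightarrow> 'x \<Rightarrow> 'y \<Rightarrow> 'o \<Rightarrow> real) \<Rightarrow> ('p \<Rightarrow> 'y::real_inner set) \<Rightarrow>
     ('p \<Rightarrow> 'y \<Rightarrow> 'x \<Rightarrow> 'o \<Rightarrow> 'y) \<Rightarrow> 'p \<Rightarrow> 'x \<Rightarrow> real" where
  "objective Q ft Y F i x = (LINT \<omega>|Q. ft i x (lower_response Y F i x \<omega>) \<omega>)"

definition partial_subdiff ::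
    "('d::finite \<Rightarrow> 'p) \<Rightarrow> ('p \<Rightarrow> real ^ 'd \<Rightarrow> real) \<Rightarrow> 'p \<Rightarrow> real ^ 'd \<Rightarrow> (real ^ 'd) set" where
  "partial_subdiff own f i x =
     {g \<in> stratspace own i. \<forall>v \<in> stratspace own i.
        f i x + g \<bullet> (v - block own i x) \<le> f i (repl own i v x)}"

text \<open>
  The uniform distribution on the unit ball of \<open>stratspace own i\<close>: normalised
  \<open>n_i\<close>-dimensional Lebesgue measure, pushed forward to \<open>real ^ 'd\<close> by padding with zeros.
\<close>

definition unif_ball :: "('d::finite \<Rightarrow> 'p) \<Rightarrow> 'p \<Rightarrow> (real ^ 'd) measure" where
  "unif_ball own i =
     (let R = Pi\<^sub>M {d. own d = i} (\<lambda>_. lborel :: real measure)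
      in distr (uniform_measure R {u \<in> space R. (\<Sum>d | own d = i. (u d)\<^sup>2) \<le> 1}) borel
           (\<lambda>u. \<chi> d. if own d = i then u d else 0))"

text \<open>
  The distribution is supported on \<open>stratspace own i\<close>, where \<open>block own i u = u\<close>; writing the block
  keeps the integrand measurable when nothing is known of \<open>f i\<close> off the feasible \<open>x\<^sup>-\<^sup>i\<close>.
\<close>

definition smoothed ::
    "('d::finite \<Rightarrow> 'p) \<Rightarrow> real \<Rightarrow> ('p \<Rightarrow> real ^ 'd \<Rightarrow> real) \<Rightarrow> 'p \<Rightarrow> real ^ 'd \<Rightarrow> real" where
  "smoothed own \<eta> f i x = (LINT u|unif_ball own i. f i (x + \<eta> *\<^sub>R block own i u))"

definition is_potential ::
    "('d::finite \<Rightarrow> 'p) \<Rightarrow> ('p \<Rightarrow> (real ^ 'd) set) \<Rightarrow> ('p \<Rightarrow> real ^ 'd \<Rightarrow> real) \<Rightarrow>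
     (real ^ 'd \<Rightarrow> real) \<Rightarrow> bool" where
  "is_potential own X g P \<longleftrightarrow>
     (\<forall>i. \<forall>x \<in> rivals_feasible own X i. \<forall>u \<in> X i. \<forall>v \<in> X i.
        P (repl own i u x) - P (repl own i v x) = g i (repl own i u x) - g i (repl own i v x))"

definition nash_equilibria ::
    "('d::finite \<Rightarrow> 'p) \<Rightarrow> ('p \<Rightarrow> (real ^ 'd) set) \<Rightarrow> ('p \<Rightarrow> real ^ 'd \<Rightarrow> real) \<Rightarrow> (real ^ 'd) set" where
  "nash_equilibria own X g =
     {x \<in> profiles own X. \<forall>i. \<forall>v \<in> X i. g i x \<le> g i (repl own i v x)}"

definition prox_response ::
    "('d::finite \<Rightarrow> 'p) \<Rightarrow> ('p \<Rightarrow> (real ^ 'd) set) \<Rightarrow> ('p \<Rightarrow> real ^ 'd \<Rightarrow> real) \<Rightarrow> real \<Rightarrow>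
     'p \<Rightarrow> real ^ 'd \<Rightarrow> real ^ 'd" where
  "prox_response own X g c i x =
     arg_min_on (\<lambda>v. g i (repl own i v x) + c / 2 * (norm (v - block own i x))\<^sup>2) (X i)"

text \<open>
  \<open>history M x0 sel smp S k\<close> is the sigma-algebra generated by \<open>x0\<close>, the players \<open>sel l\<close> selected
  and the samples \<open>smp l\<close> used in the iterations \<open>l < k\<close> (all samples of one iteration are bundled
  into one random element of \<open>S l\<close>).  \<open>history_sel\<close> adds the player selected in iteration \<open>k\<close>.
\<close>

definition history ::
    "'w measure \<Rightarrow> ('w \<Rightarrow> 'x::topological_space) \<Rightarrow> (nat \<Rightarrow> 'w \<Rightarrow> 'p) \<Rightarrow> (nat \<Rightarrow> 'w \<Rightarrow> 's) \<Rightarrow>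
     (nat \<Rightarrow> 's measure) \<Rightarrow> nat \<Rightarrow> 'w measure" where
  "history M x0 sel smp S k = sigma (space M)
     ({x0 -` A \<inter> space M | A. A \<in> sets borel}
      \<union> (\<Union>l<k. {sel l -` A \<inter> space M | A. A \<in> UNIV})
      \<union> (\<Union>l<k. {smp l -` A \<inter> space M | A. A \<in> sets (S l)}))"

definition history_sel ::
    "'w measure \<Rightarrow> ('w \<Rightarrow> 'x::topological_space) \<Rightarrow> (nat \<Rightarrow> 'w \<Rightarrow> 'p) \<Rightarrow> (nat \<Rightarrow> 'w \<Rightarrow> 's) \<Rightarrow>
     (nat \<Rightarrow> 's measure) \<Rightarrow> nat \<Rightarrow> 'w measure" where
  "history_sel M x0 sel smp S k = sigma (space M)
     (sets (history M x0 sel smp S k) \<union> {sel k -` A \<inter> space M | A. A \<in> UNIV})"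

text \<open>
  Conditional expectation of a nonnegative random variable with values in the extended reals, so
  that no integrability is needed.
\<close>

definition cond_expect :: "'w measure \<Rightarrow> 'w measure \<Rightarrow> ('w \<Rightarrow> real) \<Rightarrow> 'w \<Rightarrow> ereal" where
  "cond_expect M F Z w = enn2ereal (nn_cond_exp M F (\<lambda>v. ennreal (Z v)) w)"

text \<open>
  Convergence to a set: every cluster point lies in the set, and along a bounded sequence the set
  is nonempty and the distance to it tends to zero.  Without boundedness the distance need not
  tend to zero in the situation considered here, and the set may even be empty (note that
  \<open>infdist x {} = 0\<close>).
\<close>

definition converges_to_set :: "(nat \<Rightarrow> 'a::metric_space) \<Rightarrow> 'a set \<Rightarrow> bool" where
  "converges_to_set s A \<longleftrightarrow>
     (\<forall>r l. strict_mono r \<and> (\<lambda>n. s (r n)) \<longlonglongrightarrow> l \<longrightarrow> l \<in> A) \<and>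
     (bounded (range s) \<longrightarrow> A \<noteq> {} \<and> (\<lambda>n. infdist (s n) A) \<longlonglongrightarrow> 0)"

end

theory Submission
  imports Defs
begin

text \<open>
  Along feasible profiles \<open>P\<close> and every objective differ, in the own block, by a constant only.
  Prox optimality and the descent lemma therefore give, pathwise, that the step of the selected
  player decreases \<open>P\<close> by \<open>\<gamma>\<^sub>k (c - L \<gamma>\<^sub>k / 2)\<close> times its squared residual, up to
  \<open>\<Sum>j. M\<^sub>j \<parallel>\<epsilon>\<^sup>j\<parallel>\<close>; conditioning gives (a).  For (b), stopping arguments
  transfer almost sure summability from the conditional expectations of the errors to the errors, and,
  after telescoping, from the decreases of the selected players to their conditional expectations.
  The residuals are Hoelder continuous of exponent 1/2 in the distance that weights block \<open>j\<close> by
  \<open>M\<^sub>j\<close>; hence they vary slowly along the path, and diminishing steps with a non-summable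
  \<open>\<gamma>\<close> force them to tend to 0.  For (c), residuals are continuous and vanish only at
  equilibria.
\<close>

section \<open>Blocks of a profile\<close>

text \<open>The gradient of an objective is assumed Lipschitz in the own block only; no continuity
  in the rivals' blocks is given, so best responses at two profiles cannot be compared through
  gradients. What can be compared are values of the potential: changing one block at a time shows it
  to be Lipschitz on feasible profiles, and the quadratic growth of the prox problem turns
  differences of values into squared distances of residuals. This is the origin of the exponent 1/2.

  The expectation of \<open>P (x 0 w)\<close> may be infinite. Therefore telescoping is done path by
  path, and conditional expectations are those of nonnegative extended functions.

  Summability of \<open>\<gamma> k\<close> times the squared residual, with non-summable weights,
  only makes the lower limit of the residuals vanish. Slow variation is what excludes recurring
  excursions away from 0.\<close>

lemma block_add: "block own i (x + y) = block own i x + block own i y"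
  by (simp add: block_def vec_eq_iff)

lemma bounded_linear_block: "bounded_linear (block own i)"
  unfolding linear_conv_bounded_linear[symmetric]
  by (intro linearI) (simp_all add: block_def vec_eq_iff)

lemmas continuous_on_block [continuous_intros] =
  bounded_linear.continuous_on[OF bounded_linear_block]

lemmas tendsto_block [tendsto_intros] = bounded_linear.tendsto[OF bounded_linear_block]

lemma block_measurable [measurable]: "block own i \<in> borel_measurable borel"
  by (intro borel_measurable_continuous_onI continuous_intros)

lemma block_stratspace: "v \<in> stratspace own i \<Longrightarrow> block own i v = v"
  by (auto simp: block_def stratspace_def vec_eq_iff)

lemma block_repl: "block own i (repl own i v x) = block own i v"
  by (simp add: block_def repl_def vec_eq_iff)

lemma block_repl_other: "j \<noteq> i \<Longrightarrow> block own j (repl own i v x) = block own j x"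
  by (auto simp add: block_def repl_def vec_eq_iff)

lemma repl_block: "repl own i (block own i v) x = repl own i v x"
  by (auto simp add: block_def repl_def vec_eq_iff)

lemma repl_same: "repl own i x x = x"
  by (auto simp add: repl_def vec_eq_iff)

lemma repl_repl: "repl own i v (repl own i u x) = repl own i v x"
  by (auto simp add: repl_def vec_eq_iff)

lemma repl_eqI:
  assumes "\<And>j. j \<noteq> i \<Longrightarrow> block own j y = block own j x"
  shows "repl own i (block own i y) x = y"
  using assms unfolding block_def repl_def vec_eq_iff by (auto; metis)

lemma profiles_rivals: "x \<in> profiles own X \<Longrightarrow> x \<in> rivals_feasible own X i"
  by (simp add: profiles_def rivals_feasible_def)

text \<open>\<open>arg_min_on\<close> is a Hilbert choice, so nothing is known about its value until
  some minimizer has been exhibited.\<close>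

lemma arg_min_on_is_min:
  fixes f :: "'a \<Rightarrow> 'b::linorder"
  assumes "m \<in> S" "\<And>v. v \<in> S \<Longrightarrow> f m \<le> f v"
  shows "arg_min_on f S \<in> S" "v \<in> S \<Longrightarrow> f (arg_min_on f S) \<le> f v"
proof -
  have "is_arg_min f (\<lambda>x. x \<in> S) (arg_min_on f S)"
    unfolding arg_min_on_def arg_min_def
    by (rule someI[of _ m]) (use assms in \<open>auto simp: is_arg_min_linorder\<close>)
  then show "arg_min_on f S \<in> S" "v \<in> S \<Longrightarrow> f (arg_min_on f S) \<le> f v"
    by (auto simp: is_arg_min_linorder)
qed

section \<open>Proximal best responses in a smooth potential game\<close>

locale smooth_potential_game =
  fixes own :: "'d::finite \<Rightarrow> 'p::finite"
    and X :: "'p \<Rightarrow> (real ^ 'd) set"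
    and g :: "'p \<Rightarrow> real ^ 'd \<Rightarrow> real"
    and G :: "'p \<Rightarrow> real ^ 'd \<Rightarrow> real ^ 'd"
    and P :: "real ^ 'd \<Rightarrow> real"
    and L c :: real
    and Mb :: "'p \<Rightarrow> real"
  assumes X_sub: "\<And>i. X i \<subseteq> stratspace own i"
    and X_closed: "\<And>i. closed (X i)"
    and X_convex: "\<And>i. convex (X i)"
    and g_convex: "\<And>i x. x \<in> rivals_feasible own X i \<Longrightarrow>
          convex_on (X i) (\<lambda>v. g i (repl own i v x))"
    and G_grad: "\<And>i x. x \<in> profiles own X \<Longrightarrow> GDERIV (\<lambda>v. g i (repl own i v x)) x :> G i x"
    and G_Lipschitz: "\<And>i x u v. x \<in> rivals_feasible own X i \<Longrightarrow> u \<in> X i \<Longrightarrow> v \<in> X i \<Longrightarrow>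
          norm (G i (repl own i u x) - G i (repl own i v x)) \<le> L * norm (u - v)"
    and G_bound: "\<And>i x. x \<in> profiles own X \<Longrightarrow> norm (G i x) \<le> Mb i"
    and P_potential: "is_potential own X g P"
    and c_pos: "c > 0"
begin

abbreviation "feas \<equiv> profiles own X"
abbreviation "B \<equiv> prox_response own X g c"

definition resid :: "'p \<Rightarrow> real ^ 'd \<Rightarrow> real ^ 'd" where
  "resid i x = B i x - block own i x"

text \<open>Weighting the blocks by the gradient bounds makes the coordinates of a player with
  \<open>Mb j = 0\<close> invisible; the errors in these coordinates are not controlled.\<close>

definition wdist :: "real ^ 'd \<Rightarrow> real ^ 'd \<Rightarrow> real" where
  "wdist x y = (\<Sum>j\<in>UNIV. Mb j * norm (block own j x - block own j y))"

lemma feas_block: "x \<in> feas \<Longrightarrow> block own i x \<in> X i"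
  by (simp add: profiles_def)

lemma feas_repl: "x \<in> feas \<Longrightarrow> v \<in> X i \<Longrightarrow> repl own i v x \<in> feas"
  unfolding profiles_def
  by (smt (verit, best) X_sub block_repl block_repl_other block_stratspace mem_Collect_eq subsetD)

lemma X_seg: "u \<in> X i \<Longrightarrow> v \<in> X i \<Longrightarrow> 0 \<le> t \<Longrightarrow> t \<le> 1 \<Longrightarrow> u + t *\<^sub>R (v - u) \<in> X i"
  using convexD_alt[OF X_convex, of u i v t] by (simp add: algebra_simps)

lemma closed_feas: "closed feas"
proof -
  have "feas = (\<Inter>i. block own i -` X i)"
    by (auto simp: profiles_def)
  then show ?thesis
    using X_closed by (auto intro!: closed_INT continuous_closed_vimage
        linear_continuous_at[OF bounded_linear_block])
qed

lemma Mb_nonneg: "x \<in> feas \<Longrightarrow> 0 \<le> Mb i"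
  using G_bound[of x i] norm_ge_zero[of "G i x"] by linarith

lemma potential_diff:
  assumes "x \<in> feas" "u \<in> X i" "v \<in> X i"
  shows "P (repl own i u x) - P (repl own i v x) = g i (repl own i u x) - g i (repl own i v x)"
  by (rule P_potential[unfolded is_potential_def, rule_format, OF profiles_rivals[OF assms(1)] assms(2,3)])

section \<open>Calculus along a segment of the own strategy set\<close>

lemma g_segment_deriv:
  assumes x: "x \<in> feas" and u: "u \<in> X i" and v: "v \<in> X i" and t: "0 \<le> t" "t \<le> 1"
  shows "((\<lambda>s. g i (repl own i (u + s *\<^sub>R (v - u)) x)) has_real_derivative
           G i (repl own i (u + t *\<^sub>R (v - u)) x) \<bullet> (v - u)) (at t)"
proof -
  define y where "y = repl own i (u + t *\<^sub>R (v - u)) x"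
  have y: "y \<in> feas"
    unfolding y_def by (intro feas_repl x X_seg u v t)
  have repl_y: "repl own i w y = repl own i w x" for w
    by (simp add: y_def repl_repl)
  define \<phi> where "\<phi> = (\<lambda>w. g i (repl own i w x))"
  have "(\<phi> has_derivative (\<lambda>h. h \<bullet> G i y)) (at (y + (t - t) *\<^sub>R (v - u)))"
    using G_grad[OF y, of i] by (simp add: gderiv_def repl_y \<phi>_def)
  then have "((\<lambda>s. \<phi> (y + (s - t) *\<^sub>R (v - u))) has_derivative
               (\<lambda>h. (h *\<^sub>R (v - u)) \<bullet> G i y)) (at t)"
    by (rule has_derivative_compose[rotated]) (auto intro!: derivative_eq_intros)
  \<comment> \<open>\<open>G_grad\<close> differentiates at the whole profile \<open>y\<close>,
    while the segment runs through strategies. Both give the same value, since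
    \<open>repl own i\<close> reads only the coordinates of player \<open>i\<close>.\<close>
  moreover have "\<phi> (y + (s - t) *\<^sub>R (v - u)) = g i (repl own i (u + s *\<^sub>R (v - u)) x)" for s
  proof -
    have "repl own i (y + (s - t) *\<^sub>R (v - u)) x = repl own i (u + s *\<^sub>R (v - u)) x"
      by (simp add: y_def repl_def vec_eq_iff algebra_simps)
    then show ?thesis by (simp add: \<phi>_def)
  qed
  ultimately show ?thesis
    by (simp add: has_field_derivative_def y_def inner_commute mult_commute_abs)
qed

lemma g_lipschitz:
  assumes x: "x \<in> feas" and u: "u \<in> X i" and v: "v \<in> X i"
  shows "\<bar>g i (repl own i v x) - g i (repl own i u x)\<bar> \<le> Mb i * norm (v - u)"
proof -
  let ?h = "\<lambda>s. g i (repl own i (u + s *\<^sub>R (v - u)) x)"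
  obtain t where t: "0 < t" "t < 1"
    and eq: "?h 1 - ?h 0 = (1 - 0) * (G i (repl own i (u + t *\<^sub>R (v - u)) x) \<bullet> (v - u))"
    using MVT2[of 0 1 ?h "\<lambda>t. G i (repl own i (u + t *\<^sub>R (v - u)) x) \<bullet> (v - u)"]
      g_segment_deriv[OF x u v] by auto
  have "norm (G i (repl own i (u + t *\<^sub>R (v - u)) x)) \<le> Mb i"
    using t by (intro G_bound feas_repl x X_seg u v) auto
  then have "\<bar>G i (repl own i (u + t *\<^sub>R (v - u)) x) \<bullet> (v - u)\<bar> \<le> Mb i * norm (v - u)"
    by (meson Cauchy_Schwarz_ineq2 mult_right_mono norm_ge_zero order_trans)
  then show ?thesis using eq by simp
qed

lemma g_descent:
  assumes x: "x \<in> feas" and u: "u \<in> X i" and v: "v \<in> X i"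
  shows "g i (repl own i v x) \<le> g i (repl own i u x) + G i (repl own i u x) \<bullet> (v - u)
           + L / 2 * (norm (v - u))\<^sup>2"
proof -
  let ?y = "\<lambda>s. repl own i (u + s *\<^sub>R (v - u)) x"
  let ?G0 = "G i (repl own i u x) \<bullet> (v - u)"
  \<comment> \<open>The gap between the objective on the segment and its quadratic upper model; the
    Lipschitz bound makes it nonincreasing.\<close>
  define h where "h = (\<lambda>s. g i (?y s) - s * ?G0 - L / 2 * s\<^sup>2 * (norm (v - u))\<^sup>2)"
  have "h 1 \<le> h 0"
  proof (rule DERIV_nonpos_imp_nonincreasing[of 0 1 h])
    fix t :: real assume t: "0 \<le> t" "t \<le> 1"
    have "(h has_real_derivative G i (?y t) \<bullet> (v - u) - ?G0 - L * t * (norm (v - u))\<^sup>2) (at t)"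
      unfolding h_def by (rule derivative_eq_intros g_segment_deriv[OF x u v t] refl | simp)+
    moreover have "G i (?y t) \<bullet> (v - u) - ?G0 - L * t * (norm (v - u))\<^sup>2 \<le> 0"
    proof -
      have "G i (?y t) \<bullet> (v - u) - ?G0 = (G i (?y t) - G i (repl own i u x)) \<bullet> (v - u)"
        by (simp add: inner_diff_left)
      also have "\<dots> \<le> norm (G i (?y t) - G i (repl own i u x)) * norm (v - u)"
        by (rule norm_cauchy_schwarz)
      also have "\<dots> \<le> (L * norm (u + t *\<^sub>R (v - u) - u)) * norm (v - u)"
        by (intro mult_right_mono G_Lipschitz profiles_rivals x X_seg u v t) auto
      also have "\<dots> = L * t * (norm (v - u))\<^sup>2"
        using t by (simp add: power2_eq_square)
      finally show ?thesis by simp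
    qed
    ultimately show "\<exists>d. (h has_real_derivative d) (at t) \<and> d \<le> 0" by blast
  qed simp
  then show ?thesis by (simp add: h_def)
qed

lemma g_above_tangent:
  assumes x: "x \<in> feas" and u: "u \<in> X i" and v: "v \<in> X i"
  shows "g i (repl own i u x) + G i (repl own i u x) \<bullet> (v - u) \<le> g i (repl own i v x)"
proof -
  let ?h = "\<lambda>s. g i (repl own i (u + s *\<^sub>R (v - u)) x)"
  have "(?h has_real_derivative G i (repl own i u x) \<bullet> (v - u)) (at 0)"
    using g_segment_deriv[OF x u v, of 0] by simp
  then have "((\<lambda>t. (?h t - ?h 0) / (t - 0)) \<longlongrightarrow> G i (repl own i u x) \<bullet> (v - u)) (at 0)"
    by (simp add: has_field_derivative_iff)
  \<comment> \<open>Convexity is available only inside \<open>X i\<close>, that is for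
    \<open>t\<close> between 0 and 1, so the limit is taken from the right.\<close>
  then have lim: "((\<lambda>t. (?h t - ?h 0) / t) \<longlongrightarrow> G i (repl own i u x) \<bullet> (v - u)) (at_right 0)"
    by (simp add: filterlim_at_split)
  have "(?h t - ?h 0) / t \<le> g i (repl own i v x) - g i (repl own i u x)" if "0 < t" "t < 1" for t
  proof -
    have "?h t \<le> (1 - t) * g i (repl own i u x) + t * g i (repl own i v x)"
      using convex_onD[OF g_convex[OF profiles_rivals[OF x]], of t u i v] that u v
      by (simp add: algebra_simps)
    then show ?thesis using that by (simp add: field_simps)
  qed
  then have "\<forall>\<^sub>F t in at_right 0. (?h t - ?h 0) / t \<le> g i (repl own i v x) - g i (repl own i u x)"
    by (intro eventually_at_rightI[of 0 1]) auto
  from tendsto_upperbound[OF lim this] show ?thesis by simp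
qed

section \<open>Proximal best responses and their residuals\<close>

lemma prox_exists:
  assumes x: "x \<in> feas"
  obtains m where "m \<in> X i"
    "\<And>v. v \<in> X i \<Longrightarrow> g i (repl own i m x) + c / 2 * (norm (m - block own i x))\<^sup>2
                  \<le> g i (repl own i v x) + c / 2 * (norm (v - block own i x))\<^sup>2"
proof -
  let ?b = "block own i x"
  let ?\<phi> = "\<lambda>v. g i (repl own i v x) + c / 2 * (norm (v - ?b))\<^sup>2"
  \<comment> \<open>Beyond this radius the prox term \<open>c / 2 * s^2\<close> exceeds
    \<open>Mb i * s\<close>, the most by which the objective can fall at distance \<open>s\<close>.
    A minimizer over the ball is then one over \<open>X i\<close>.\<close>
  define r where "r = 2 * Mb i / c"
  define K where "K = X i \<inter> cball ?b r"
  have b: "?b \<in> X i" by (rule feas_block[OF x])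
  have M0: "0 \<le> Mb i" by (rule Mb_nonneg[OF x])
  then have r: "0 \<le> r" using c_pos by (simp add: r_def)
  have "(Mb i)-lipschitz_on (X i) (\<lambda>v. g i (repl own i v x))"
    using g_lipschitz[OF x] M0 by (intro lipschitz_onI) (auto simp: dist_norm)
  then have "continuous_on (X i) (\<lambda>v. g i (repl own i v x))"
    by (rule lipschitz_on_continuous_on)
  then have "continuous_on K ?\<phi>"
    unfolding K_def by (intro continuous_intros) (rule continuous_on_subset, auto)
  moreover have "compact K"
    unfolding K_def using X_closed by (intro closed_Int_compact) auto
  moreover have "?b \<in> K" using b r by (simp add: K_def)
  ultimately obtain m where m: "m \<in> K" "\<And>v. v \<in> K \<Longrightarrow> ?\<phi> m \<le> ?\<phi> v"
    using continuous_attains_inf[of K ?\<phi>] by blast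
  have "?\<phi> m \<le> ?\<phi> v" if v: "v \<in> X i" for v
  proof (cases "v \<in> K")
    case False
    then have far: "r < norm (v - ?b)" using v by (simp add: K_def dist_norm norm_minus_commute)
    have "Mb i * norm (v - ?b) \<le> c / 2 * (norm (v - ?b))\<^sup>2"
    proof -
      have "Mb i \<le> c / 2 * norm (v - ?b)" using far c_pos by (simp add: r_def field_simps)
      then have "Mb i * norm (v - ?b) \<le> (c / 2 * norm (v - ?b)) * norm (v - ?b)"
        by (rule mult_right_mono) simp
      then show ?thesis by (simp add: power2_eq_square mult.assoc)
    qed
    moreover have "g i (repl own i ?b x) - g i (repl own i v x) \<le> Mb i * norm (v - ?b)"
      using g_lipschitz[OF x b v] by linarith
    ultimately have "?\<phi> ?b \<le> ?\<phi> v" by simp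
    then show ?thesis using m(2)[OF \<open>?b \<in> K\<close>] by linarith
  qed (rule m(2))
  with m(1) show thesis using that[of m] by (simp add: K_def)
qed

lemma
  assumes x: "x \<in> feas"
  shows B_in: "B i x \<in> X i"
    and B_min: "v \<in> X i \<Longrightarrow>
      g i (repl own i (B i x) x) + c / 2 * (norm (B i x - block own i x))\<^sup>2
        \<le> g i (repl own i v x) + c / 2 * (norm (v - block own i x))\<^sup>2"
proof -
  obtain m where m: "m \<in> X i"
    "\<And>v. v \<in> X i \<Longrightarrow> g i (repl own i m x) + c / 2 * (norm (m - block own i x))\<^sup>2
                  \<le> g i (repl own i v x) + c / 2 * (norm (v - block own i x))\<^sup>2"
    using prox_exists[OF x, of i] by blast
  note * = arg_min_on_is_min[of m "X i"
      "\<lambda>v. g i (repl own i v x) + c / 2 * (norm (v - block own i x))\<^sup>2", OF m]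
  show "B i x \<in> X i" unfolding prox_response_def by (rule *(1)) auto
  show "g i (repl own i (B i x) x) + c / 2 * (norm (B i x - block own i x))\<^sup>2
        \<le> g i (repl own i v x) + c / 2 * (norm (v - block own i x))\<^sup>2" if "v \<in> X i"
    unfolding prox_response_def by (rule *(2)) (use that in auto)
qed

text \<open>First-order optimality in which the objective stays a difference of values instead of
  being linearized: values, unlike gradients, can be exchanged for those of \<open>P\<close> and
  compared between profiles. The proof tests the minimum on the segment towards \<open>v\<close>,
  divides by \<open>t\<close> and lets \<open>t\<close> tend to 0.\<close>

lemma B_variational:
  assumes x: "x \<in> feas" and v: "v \<in> X i"
  shows "c * ((block own i x - B i x) \<bullet> (v - B i x)) \<le> g i (repl own i v x) - g i (repl own i (B i x) x)"
proof -
  let ?b = "B i x" and ?x = "block own i x" and ?g = "\<lambda>v. g i (repl own i v x)"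
  have b: "?b \<in> X i" by (rule B_in[OF x])
  have *: "c * ((?x - ?b) \<bullet> (v - ?b)) \<le> ?g v - ?g ?b + t * (c / 2 * (norm (v - ?b))\<^sup>2)"
    if t: "0 < t" "t < 1" for t
  proof -
    have expand: "t * (c * I) \<le> t * (gv - gb + t * (c / 2 * N))"
      if "gz \<le> (1 - t) * gb + t * gv" "gb + c / 2 * R \<le> gz + c / 2 * R'"
        "R' = R - 2 * t * I + t\<^sup>2 * N" for gz gb gv I N R R'
      using that by (simp add: algebra_simps power2_eq_square)
    have "?g (?b + t *\<^sub>R (v - ?b)) \<le> (1 - t) * ?g ?b + t * ?g v"
      using convex_onD[OF g_convex[OF profiles_rivals[OF x]], of t ?b i v] t b v
      by (simp add: algebra_simps)
    moreover have "?g ?b + c / 2 * (norm (?b - ?x))\<^sup>2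
        \<le> ?g (?b + t *\<^sub>R (v - ?b)) + c / 2 * (norm (?b + t *\<^sub>R (v - ?b) - ?x))\<^sup>2"
      by (rule B_min[OF x X_seg]) (use b v t in auto)
    moreover have "(norm (?b + t *\<^sub>R (v - ?b) - ?x))\<^sup>2 =
        (norm (?b - ?x))\<^sup>2 - 2 * t * ((?x - ?b) \<bullet> (v - ?b)) + t\<^sup>2 * (norm (v - ?b))\<^sup>2"
      unfolding power2_norm_eq_inner
      by (simp add: inner_add_left inner_add_right inner_diff_left inner_diff_right
          inner_commute power2_eq_square algebra_simps)
    ultimately have "t * (c * ((?x - ?b) \<bullet> (v - ?b)))
        \<le> t * (?g v - ?g ?b + t * (c / 2 * (norm (v - ?b))\<^sup>2))"
      by (rule expand)
    then show ?thesis using t by simp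
  qed
  have "((\<lambda>t. ?g v - ?g ?b + t * (c / 2 * (norm (v - ?b))\<^sup>2)) \<longlongrightarrow>
          ?g v - ?g ?b + 0 * (c / 2 * (norm (v - ?b))\<^sup>2)) (at_right 0)"
    by (intro tendsto_intros)
  moreover have "\<forall>\<^sub>F t in at_right (0::real). c * ((?x - ?b) \<bullet> (v - ?b))
      \<le> ?g v - ?g ?b + t * (c / 2 * (norm (v - ?b))\<^sup>2)"
    using * by (intro eventually_at_rightI[of 0 1]) auto
  ultimately have "c * ((?x - ?b) \<bullet> (v - ?b)) \<le> ?g v - ?g ?b + 0 * (c / 2 * (norm (v - ?b))\<^sup>2)"
    by (rule tendsto_lowerbound) simp
  then show ?thesis by simp
qed

text \<open>Comparing the prox values at the two points directly would give only
  \<open>c / 2\<close>; \<open>B_variational\<close> gives the full \<open>c\<close> that appears in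
  (a).\<close>

lemma G_resid:
  assumes x: "x \<in> feas"
  shows "c * (norm (resid i x))\<^sup>2 \<le> - (G i x \<bullet> resid i x)"
proof -
  have "c * ((block own i x - B i x) \<bullet> (block own i x - B i x)) \<le>
      g i (repl own i (block own i x) x) - g i (repl own i (B i x) x)"
    by (rule B_variational[OF x feas_block[OF x]])
  moreover have "g i (repl own i (block own i x) x)
      + G i (repl own i (block own i x) x) \<bullet> (B i x - block own i x) \<le> g i (repl own i (B i x) x)"
    by (rule g_above_tangent[OF x feas_block[OF x] B_in[OF x]])
  ultimately show ?thesis
    by (simp add: resid_def repl_block repl_same power2_norm_eq_inner inner_diff_left
        inner_diff_right algebra_simps)
qed

text \<open>A bound that comes from gradients and not from compactness of the strategy sets. It
  bounds the decreases of the potential and makes the error-free part of a step at most a multiple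
  of \<open>\<gamma> k\<close>.\<close>

lemma norm_resid_le:
  assumes x: "x \<in> feas"
  shows "c * norm (resid i x) \<le> Mb i"
proof (cases "resid i x = 0")
  case False
  have "c * (norm (resid i x))\<^sup>2 \<le> norm (G i x) * norm (resid i x)"
    using G_resid[OF x, of i] Cauchy_Schwarz_ineq2[of "G i x" "resid i x"] by linarith
  also have "\<dots> \<le> Mb i * norm (resid i x)"
    by (intro mult_right_mono G_bound x) simp
  finally show ?thesis using False by (simp add: power2_eq_square)
qed (use Mb_nonneg[OF x] in simp)

lemma descent:
  assumes x: "x \<in> feas" and z: "block own i x + \<gamma> *\<^sub>R resid i x \<in> X i" and \<gamma>: "0 \<le> \<gamma>"
  shows "P (repl own i (block own i x + \<gamma> *\<^sub>R resid i x) x)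
           \<le> P x - \<gamma> * (c - L * \<gamma> / 2) * (norm (resid i x))\<^sup>2"
proof -
  let ?z = "block own i x + \<gamma> *\<^sub>R resid i x"
  have "P (repl own i ?z x) - P x = g i (repl own i ?z x) - g i x"
    using potential_diff[OF x z feas_block[OF x]] by (simp add: repl_block repl_same)
  also have "\<dots> \<le> \<gamma> * (G i x \<bullet> resid i x) + L / 2 * (\<gamma> * norm (resid i x))\<^sup>2"
    using g_descent[OF x feas_block[OF x] z] \<gamma> by (simp add: repl_block repl_same)
  also have "\<dots> \<le> \<gamma> * - (c * (norm (resid i x))\<^sup>2) + L / 2 * (\<gamma> * norm (resid i x))\<^sup>2"
    using G_resid[OF x, of i] \<gamma> by (intro add_right_mono mult_left_mono) auto
  also have "\<dots> = - \<gamma> * (c - L * \<gamma> / 2) * (norm (resid i x))\<^sup>2"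
    by (simp add: power2_eq_square algebra_simps)
  finally show ?thesis by simp
qed

section \<open>Potential and residuals in the weighted distance\<close>

lemma P_wdist:
  assumes x: "x \<in> feas" and y: "y \<in> feas"
  shows "\<bar>P y - P x\<bar> \<le> wdist y x"
proof -
  \<comment> \<open>The potential identity speaks about one block at a time, so \<open>x\<close> is
    turned into \<open>y\<close> player by player; \<open>mix J\<close> is the hybrid in which the
    players of \<open>J\<close> have already moved.\<close>
  define mix where "mix = (\<lambda>J. \<chi> d. if own d \<in> J then y $ d else x $ d)"
  have mix_feas: "mix J \<in> feas" for J
  proof -
    have "block own i (mix J) = (if i \<in> J then block own i y else block own i x)" for i
      by (auto simp: mix_def block_def vec_eq_iff)
    then show ?thesis using x y by (auto simp: profiles_def)
  qed
  have "\<bar>P (mix J) - P x\<bar> \<le> (\<Sum>j\<in>J. Mb j * norm (block own j y - block own j x))" for J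
  proof (induction J rule: finite_induct[OF finite])
    case 1
    then show ?case by (simp add: mix_def)
  next
    case (2 j J)
    have m1: "mix (insert j J) = repl own j (block own j y) (mix J)"
      by (auto simp: mix_def repl_def block_def vec_eq_iff)
    have m0: "mix J = repl own j (block own j x) (mix J)"
      using 2 by (auto simp: mix_def repl_def block_def vec_eq_iff)
    have "\<bar>P (mix (insert j J)) - P (mix J)\<bar>
        = \<bar>g j (repl own j (block own j y) (mix J)) - g j (repl own j (block own j x) (mix J))\<bar>"
      using potential_diff[OF mix_feas feas_block[OF y] feas_block[OF x], of j J] m0 m1 by simp
    also have "\<dots> \<le> Mb j * norm (block own j y - block own j x)"
      by (rule g_lipschitz[OF mix_feas feas_block[OF x] feas_block[OF y]])
    finally show ?case using 2 by simp
  qed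
  from this[of UNIV] show ?thesis by (simp add: mix_def wdist_def)
qed

lemma wdist_refl [simp]: "wdist x x = 0"
  by (simp add: wdist_def)

lemma wdist_triangle:
  assumes "x \<in> feas"
  shows "wdist x z \<le> wdist x y + wdist y z"
proof -
  have "wdist x z \<le> (\<Sum>j\<in>UNIV. Mb j * (norm (block own j x - block own j y) + norm (block own j y - block own j z)))"
    unfolding wdist_def
    by (intro sum_mono mult_left_mono Mb_nonneg[OF assms]) (metis dist_norm dist_triangle)
  then show ?thesis by (simp add: wdist_def sum.distrib distrib_left)
qed

lemma wdist_tendsto: "(\<lambda>y. wdist y x) \<midarrow>x\<rightarrow> 0"
proof -
  have "((\<lambda>y. wdist y x) \<longlongrightarrow> wdist x x) (at x)"
    unfolding wdist_def by (intro tendsto_intros)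
  then show ?thesis by simp
qed

text \<open>Each best response is tested in the optimality inequality of the other one, and the two
  inequalities are added. Objective values are then replaced by values of \<open>P\<close>, whose
  changes are of first order in the distance, whereas the residuals enter squared.\<close>

lemma resid_wdist:
  assumes x: "x \<in> feas" and y: "y \<in> feas"
  shows "(norm (resid i x - resid i y))\<^sup>2 \<le> 2 / c * wdist x y"
proof -
  let ?b = "B i x" and ?b' = "B i y" and ?r = "resid i x" and ?r' = "resid i y"
  let ?dx = "block own i x - block own i y"
  have b: "?b \<in> X i" "?b' \<in> X i" using B_in x y by auto
  \<comment> \<open>After the replacement both profiles share block \<open>i\<close>, so the term of
    player \<open>i\<close> is missing from their distance. This saving later pays for the inner
    product with \<open>?dx\<close>.\<close>
  have P_repl: "\<bar>P (repl own i v x) - P (repl own i v y)\<bar> \<le> wdist x y - Mb i * norm ?dx"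
    if v: "v \<in> X i" for v
  proof -
    have "block own j (repl own i v x) - block own j (repl own i v y) =
        (if j = i then 0 else block own j x - block own j y)" for j
      by (simp add: block_repl block_repl_other)
    then have "wdist (repl own i v x) (repl own i v y)
        = (\<Sum>j\<in>UNIV. Mb j * norm (if j = i then 0 else block own j x - block own j y))"
      by (simp add: wdist_def)
    also have "\<dots> = wdist x y - Mb i * norm ?dx"
      unfolding wdist_def by (simp add: sum.remove[of UNIV i])
    finally show ?thesis
      using P_wdist[OF feas_repl[OF y v] feas_repl[OF x v]] by simp
  qed
  have "c * (?r \<bullet> (?b - ?b')) \<le> P (repl own i ?b' x) - P (repl own i ?b x)"
    using B_variational[OF x b(2)] potential_diff[OF x b(2,1)]
    by (simp add: resid_def inner_diff_left inner_diff_right algebra_simps)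
  moreover have "c * (?r' \<bullet> (?b' - ?b)) \<le> P (repl own i ?b y) - P (repl own i ?b' y)"
    using B_variational[OF y b(1)] potential_diff[OF y b]
    by (simp add: resid_def inner_diff_left inner_diff_right algebra_simps)
  moreover have "P (repl own i ?b' x) - P (repl own i ?b' y) \<le> wdist x y - Mb i * norm ?dx"
    using P_repl[OF b(2)] by linarith
  moreover have "P (repl own i ?b y) - P (repl own i ?b x) \<le> wdist x y - Mb i * norm ?dx"
    using P_repl[OF b(1)] by linarith
  ultimately have "c * (?r \<bullet> (?b - ?b')) + c * (?r' \<bullet> (?b' - ?b)) \<le> 2 * wdist x y - 2 * (Mb i * norm ?dx)"
    by linarith
  moreover have "c * (?r \<bullet> (?b - ?b')) + c * (?r' \<bullet> (?b' - ?b))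
      = c * (norm (?r - ?r'))\<^sup>2 + c * ((?r - ?r') \<bullet> ?dx)"
    unfolding power2_norm_eq_inner resid_def
    by (simp add: inner_diff_left inner_diff_right inner_add_left inner_add_right algebra_simps inner_commute)
  moreover have "- (c * ((?r - ?r') \<bullet> ?dx)) \<le> 2 * (Mb i * norm ?dx)"
  proof -
    have "- ((?r - ?r') \<bullet> ?dx) \<le> norm (?r - ?r') * norm ?dx"
      using Cauchy_Schwarz_ineq2[of "?r - ?r'" ?dx] by linarith
    also have "\<dots> \<le> (norm ?r + norm ?r') * norm ?dx"
      by (intro mult_right_mono norm_triangle_ineq4) simp
    finally have "c * - ((?r - ?r') \<bullet> ?dx) \<le> c * ((norm ?r + norm ?r') * norm ?dx)"
      using c_pos by (intro mult_left_mono) auto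
    also have "\<dots> = (c * norm ?r + c * norm ?r') * norm ?dx"
      by (simp add: algebra_simps)
    also have "\<dots> \<le> (Mb i + Mb i) * norm ?dx"
      by (intro mult_right_mono add_mono norm_resid_le x y) simp
    finally show ?thesis by simp
  qed
  ultimately have "c * (norm (?r - ?r'))\<^sup>2 \<le> 2 * wdist x y" by linarith
  then show ?thesis using c_pos by (simp add: field_simps)
qed

end

section \<open>Convergence of the residuals and cluster points\<close>

text \<open>On a bounded path, a subsequence staying away from \<open>A\<close> would have a further
  convergent subsequence, whose limit lies in \<open>A\<close> by assumption.\<close>

lemma converges_to_setI:
  fixes s :: "nat \<Rightarrow> 'a::heine_borel"
  assumes cluster: "\<And>r l. strict_mono r \<Longrightarrow> (\<lambda>n. s (r n)) \<longlonglongrightarrow> l \<Longrightarrow> l \<in> A"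
  shows "converges_to_set s A"
  unfolding converges_to_set_def
proof (intro conjI allI impI)
  assume bdd: "bounded (range s)"
  then obtain l r where "strict_mono r" "(s \<circ> r) \<longlonglongrightarrow> l"
    using bounded_imp_convergent_subsequence by blast
  then show A: "A \<noteq> {}"
    using cluster[of r l] by (auto simp: o_def)
  show "(\<lambda>n. infdist (s n) A) \<longlonglongrightarrow> 0"
  proof (rule ccontr)
    assume "\<not> (\<lambda>n. infdist (s n) A) \<longlonglongrightarrow> 0"
    then obtain d where d: "d > 0" "\<forall>N. \<exists>n\<ge>N. d \<le> infdist (s n) A"
      by (auto simp: LIMSEQ_iff infdist_nonneg not_less)
    then have "infinite {n. d \<le> infdist (s n) A}"
      unfolding infinite_nat_iff_unbounded_le by auto
    then obtain r :: "nat \<Rightarrow> nat" where r: "strict_mono r" "\<And>n. d \<le> infdist (s (r n)) A"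
      using infinite_enumerate[of "{n. d \<le> infdist (s n) A}"] by auto
    have "bounded (range (s \<circ> r))"
      by (rule bounded_subset[OF bdd]) auto
    then obtain l r' where r': "strict_mono r'" "((s \<circ> r) \<circ> r') \<longlonglongrightarrow> l"
      using bounded_imp_convergent_subsequence by blast
    have "strict_mono (\<lambda>n. r (r' n))"
      using r(1) r'(1) by (simp add: strict_mono_def)
    then have "l \<in> A"
      by (rule cluster) (use r'(2) in \<open>simp add: o_def\<close>)
    have "(\<lambda>n. dist (s (r (r' n))) l) \<longlonglongrightarrow> 0"
      using tendsto_dist_iff[THEN iffD1, OF r'(2)] by (simp add: o_def)
    moreover have "d \<le> dist (s (r (r' n))) l" for n
      using r(2)[of "r' n"] infdist_le[OF \<open>l \<in> A\<close>, of "s (r (r' n))"] by linarith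
    ultimately have "d \<le> 0"
      using LIMSEQ_le_const by blast
    with d(1) show False by simp
  qed
qed (use cluster in blast)

text \<open>If \<open>norm (u k) \<ge> r\<close> for a large \<open>k\<close>, slow variation keeps \<open>norm (u l) \<ge> r / 2\<close> over a
  window in which the \<open>\<gamma> l\<close> add up to a fixed amount, and this contradicts the Cauchy criterion.\<close>

lemma slowly_varying_tendsto_0:
  fixes u :: "nat \<Rightarrow> 'a::real_normed_vector" and \<gamma> e :: "nat \<Rightarrow> real"
  assumes \<gamma>: "\<And>k. 0 \<le> \<gamma> k" "\<not> summable \<gamma>"
    and sum_u: "summable (\<lambda>k. \<gamma> k * (norm (u k))\<^sup>2)"
    and e: "summable e"
    and K: "0 \<le> K" and C: "0 \<le> C"
    and var: "\<And>k m. k \<le> m \<Longrightarrow> (norm (u m - u k))\<^sup>2 \<le> K * (\<Sum>l\<in>{k..<m}. C * \<gamma> l + e l)"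
  shows "u \<longlonglongrightarrow> 0"
proof (rule LIMSEQ_I)
  fix r :: real assume r: "0 < r"
  \<comment> \<open>Chosen so that weights and errors adding up to at most \<open>\<rho>\<close>
    each move \<open>u\<close> by at most \<open>r / 2\<close>; the added 1 keeps the denominator
    positive if \<open>K = 0\<close>.\<close>
  define \<rho> where "\<rho> = (r / 2)\<^sup>2 / (K * (C + 1) + 1)"
  have den: "0 < K * (C + 1) + 1" using K C by (simp add: add_nonneg_pos)
  then have \<rho>: "0 < \<rho>" using r by (simp add: \<rho>_def)
  have \<rho>_le: "K * (C * \<rho> + \<rho>) \<le> (r / 2)\<^sup>2"
  proof -
    have "(K * (C + 1) + 1) * \<rho> = (r / 2)\<^sup>2" using den by (simp add: \<rho>_def)
    moreover have "K * (C * \<rho> + \<rho>) = (K * (C + 1) + 1) * \<rho> - \<rho>" by (simp add: algebra_simps)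
    ultimately show ?thesis using \<rho> by linarith
  qed
  obtain N1 where N1: "\<And>m n. N1 \<le> m \<Longrightarrow> norm (sum e {m..<n}) < \<rho>"
    using e \<rho> unfolding summable_Cauchy by blast
  have "0 < \<rho> * (r / 2)\<^sup>2" using \<rho> r by simp
  then obtain N2 where N2: "\<And>m n. N2 \<le> m \<Longrightarrow> norm (\<Sum>k\<in>{m..<n}. \<gamma> k * (norm (u k))\<^sup>2) < \<rho> * (r / 2)\<^sup>2"
    using sum_u unfolding summable_Cauchy by blast
  have "norm (u k) < r" if k: "max N1 N2 \<le> k" for k
  proof (rule ccontr)
    assume "\<not> norm (u k) < r"
    then have uk: "r \<le> norm (u k)" by simp
    have "\<exists>m. \<rho> < sum \<gamma> {k..<m}"
    proof (rule ccontr)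
      assume "\<not> ?thesis"
      then have le: "sum \<gamma> {k..<m} \<le> \<rho>" for m by (simp add: not_less)
      have "summable \<gamma>"
      proof (rule summableI_nonneg_bounded)
        fix n
        have "sum \<gamma> {..<n} \<le> sum \<gamma> {..<n + k}" by (rule sum_mono2) (use \<gamma> in auto)
        also have "\<dots> = sum \<gamma> {..<k} + sum \<gamma> {k..<n + k}"
          by (metis le_add2 lessThan_atLeast0 sum.atLeastLessThan_concat zero_le)
        finally show "sum \<gamma> {..<n} \<le> sum \<gamma> {..<k} + \<rho>" using le[of "n + k"] by simp
      qed (rule \<gamma>)
      with \<gamma>(2) show False ..
    qed
    \<comment> \<open>The first index at which the weights since \<open>k\<close> exceed
      \<open>\<rho>\<close>: before it \<open>u\<close> is still close to \<open>u k\<close>, yet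
      the whole window has weight above \<open>\<rho>\<close>.\<close>
    define m where "m = (LEAST m. \<rho> < sum \<gamma> {k..<m})"
    have m: "\<rho> < sum \<gamma> {k..<m}"
      unfolding m_def by (rule LeastI_ex) fact
    have less_m: "sum \<gamma> {k..<l} \<le> \<rho>" if "l < m" for l
      using not_less_Least[OF that[unfolded m_def]] by simp
    have "r / 2 \<le> norm (u l)" if l: "l \<in> {k..<m}" for l
    proof -
      have "(norm (u l - u k))\<^sup>2 \<le> K * (\<Sum>l\<in>{k..<l}. C * \<gamma> l + e l)"
        using l by (intro var) simp
      also have "\<dots> = K * (C * sum \<gamma> {k..<l} + sum e {k..<l})"
        by (simp add: sum.distrib sum_distrib_left)
      also have "\<dots> \<le> K * (C * \<rho> + \<rho>)"
        using less_m[of l] N1[of k l] k l K C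
        by (intro mult_left_mono add_mono) (auto simp: abs_less_iff)
      also note \<rho>_le
      finally have "norm (u l - u k) \<le> r / 2"
        using r by (simp add: power2_le_iff_abs_le)
      then show ?thesis
        using uk norm_triangle_ineq2[of "u k" "u l"] by (simp add: norm_minus_commute)
    qed
    then have "(r / 2)\<^sup>2 \<le> (norm (u l))\<^sup>2" if "l \<in> {k..<m}" for l
      using that r by (intro power_mono) auto
    then have "(\<Sum>l\<in>{k..<m}. \<gamma> l * (r / 2)\<^sup>2) \<le> (\<Sum>l\<in>{k..<m}. \<gamma> l * (norm (u l))\<^sup>2)"
      by (intro sum_mono mult_left_mono \<gamma>) auto
    also have "\<dots> < \<rho> * (r / 2)\<^sup>2"
      using N2[of k m] k by simp
    finally have "sum \<gamma> {k..<m} * (r / 2)\<^sup>2 < \<rho> * (r / 2)\<^sup>2"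
      by (simp add: sum_distrib_right)
    then show False using m r by simp
  qed
  then show "\<exists>no. \<forall>n\<ge>no. norm (u n - 0) < r" by (intro exI[of _ "max N1 N2"]) simp
qed

section \<open>Continuity on feasible profiles and limits that are equilibria\<close>

context smooth_potential_game
begin

text \<open>\<open>\<psi>\<close> is a modulus of continuity: the identity for \<open>P\<close>, a
  square root for the residuals.\<close>

lemma continuous_on_feasI:
  fixes h :: "real ^ 'd \<Rightarrow> 'b::real_normed_vector"
  assumes le: "\<And>x y. x \<in> feas \<Longrightarrow> y \<in> feas \<Longrightarrow> norm (h y - h x) \<le> \<psi> (wdist y x)"
    and \<psi>: "isCont \<psi> 0" "\<psi> 0 = 0"
  shows "continuous_on feas h"
  unfolding continuous_on_def
proof
  fix x assume x: "x \<in> feas"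
  have "((\<lambda>y. wdist y x) \<longlongrightarrow> 0) (at x within feas)"
    using wdist_tendsto by (rule filterlim_mono) (auto simp: at_le)
  then have "((\<lambda>y. \<psi> (wdist y x)) \<longlongrightarrow> 0) (at x within feas)"
    using isCont_tendsto_compose[OF \<psi>(1)] \<psi>(2) by fastforce
  moreover have "\<forall>\<^sub>F y in at x within feas. norm (h y - h x) \<le> \<psi> (wdist y x)"
    using le[OF x] by (auto simp: eventually_at_filter)
  ultimately have "((\<lambda>y. h y - h x) \<longlongrightarrow> 0) (at x within feas)"
    by (rule Lim_null_comparison[rotated])
  then show "(h \<longlongrightarrow> h x) (at x within feas)"
    by (simp add: LIM_zero_iff)
qed

lemma continuous_on_P: "continuous_on feas P"
  by (rule continuous_on_feasI[of _ "\<lambda>t. t"]) (use P_wdist in auto)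

lemma continuous_on_resid: "continuous_on feas (resid i)"
proof (rule continuous_on_feasI)
  show "norm (resid i y - resid i x) \<le> sqrt (2 / c * wdist y x)" if "x \<in> feas" "y \<in> feas" for x y
    by (rule real_le_rsqrt) (rule resid_wdist[OF that(2,1)])
  show "isCont (\<lambda>t. sqrt (2 / c * t)) 0"
    by (intro continuous_intros)
qed simp

text \<open>Off the feasible profiles \<open>P\<close> and \<open>resid\<close> are arbitrary, so
  measurability is obtained from continuity only after restricting the Borel space.\<close>

lemma measurable_feas:
  fixes h :: "real ^ 'd \<Rightarrow> 'b::topological_space"
  assumes h: "continuous_on feas h" and u: "u \<in> borel_measurable N" "\<And>w. w \<in> space N \<Longrightarrow> u w \<in> feas"
  shows "(\<lambda>w. h (u w)) \<in> borel_measurable N"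
proof -
  have "u \<in> measurable N (restrict_space borel feas)"
    using u by (intro measurable_restrict_space2) auto
  then show ?thesis
    using borel_measurable_continuous_on_restrict[OF h] by (rule measurable_compose)
qed

lemma nash_if_resid_0:
  assumes x: "x \<in> feas" and 0: "\<And>i. resid i x = 0"
  shows "x \<in> nash_equilibria own X g"
proof -
  have "B i x = block own i x" for i using 0[of i] by (simp add: resid_def)
  then show ?thesis
    using x B_variational[OF x] by (auto simp: nash_equilibria_def repl_block repl_same)
qed

lemma converges_to_nash:
  assumes s: "\<And>n. s n \<in> feas"
    and lim: "(\<lambda>n. \<Sum>j\<in>UNIV. (norm (block own j (s n) - B j (s n)))\<^sup>2) \<longlonglongrightarrow> 0"
  shows "converges_to_set s (nash_equilibria own X g)"
proof (rule converges_to_setI)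
  fix r l assume r: "strict_mono r" and l: "(\<lambda>n. s (r n)) \<longlonglongrightarrow> l"
  have l_feas: "l \<in> feas"
    by (rule closed_sequentially[OF closed_feas _ l]) (rule s)
  have "resid i l = 0" for i
  proof -
    have "(\<lambda>n. (norm (resid i (s n)))\<^sup>2) \<longlonglongrightarrow> 0"
    proof (rule tendsto_sandwich[OF _ _ tendsto_const lim])
      show "\<forall>\<^sub>F n in sequentially. (norm (resid i (s n)))\<^sup>2
          \<le> (\<Sum>j\<in>UNIV. (norm (block own j (s n) - B j (s n)))\<^sup>2)"
        by (intro always_eventually allI)
          (simp add: resid_def norm_minus_commute[of "B _ _"]
            member_le_sum[of i UNIV "\<lambda>j. (norm (block own j (s _) - B j (s _)))\<^sup>2"])
    qed simp
    then have "(\<lambda>n. resid i (s n)) \<longlonglongrightarrow> 0"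
      by (simp add: tendsto_norm_zero_iff)
    then have "(\<lambda>n. resid i (s (r n))) \<longlonglongrightarrow> 0"
      using LIMSEQ_subseq_LIMSEQ[OF _ r] by (simp add: o_def)
    moreover have "(\<lambda>n. resid i (s (r n))) \<longlonglongrightarrow> resid i l"
      using continuous_on_resid l l_feas s unfolding continuous_on_sequentially
      by (auto simp: o_def)
    ultimately show ?thesis using LIMSEQ_unique by blast
  qed
  then show "l \<in> nash_equilibria own X g"
    by (rule nash_if_resid_0[OF l_feas])
qed

end

section \<open>Conditional expectations\<close>

text \<open>The test includes the current term, which suits terms already known when the decision to
  stop is taken. The level is then never exceeded.\<close>

lemma stopped_sum_le:
  fixes a :: "nat \<Rightarrow> ennreal"
  shows "(\<Sum>k<n. if (\<Sum>l\<le>k. a l) \<le> N then a k else 0) \<le> N"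
proof (induction n)
  case (Suc n)
  show ?case
  proof (cases "(\<Sum>l\<le>n. a l) \<le> N")
    case True
    have "(\<Sum>k<Suc n. if (\<Sum>l\<le>k. a l) \<le> N then a k else 0) \<le> (\<Sum>k<Suc n. a k)"
      by (intro sum_mono) auto
    with True show ?thesis by (simp add: lessThan_Suc_atMost)
  qed (use Suc in simp)
qed simp

text \<open>The test looks only at earlier terms, as it must when the current one is not yet known;
  the last term kept may overshoot the level by up to \<open>C\<close>.\<close>

lemma stopped_sum_le_overshoot:
  fixes a :: "nat \<Rightarrow> ennreal"
  assumes "\<And>k. a k \<le> C"
  shows "(\<Sum>k<n. if (\<Sum>l<k. a l) \<le> N then a k else 0) \<le> N + C"
proof (induction n)
  case (Suc n)
  show ?case
  proof (cases "(\<Sum>l<n. a l) \<le> N")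
    case True
    have "(\<Sum>k<Suc n. if (\<Sum>l<k. a l) \<le> N then a k else 0) \<le> (\<Sum>k<Suc n. a k)"
      by (intro sum_mono) auto
    also have "\<dots> = (\<Sum>k<n. a k) + a n" by simp
    also have "\<dots> \<le> N + C" by (intro add_mono True assms)
    finally show ?thesis .
  qed (use Suc in simp)
qed simp

text \<open>The sums are stopped where \<open>S\<close> exceeds a level \<open>N\<close>; the stopped sums of \<open>a\<close> and \<open>b\<close> have
  the same finite expectation, and almost every path is never stopped for large \<open>N\<close>.\<close>

lemma AE_suminf_finite_transfer:
  fixes a b S :: "nat \<Rightarrow> 'w \<Rightarrow> ennreal"
  assumes sub: "\<And>k. subalgebra M (F k)"
    and S: "\<And>k. S k \<in> borel_measurable (F k)"
    and a: "\<And>k. a k \<in> borel_measurable M" and b: "\<And>k. b k \<in> borel_measurable M"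
    and transfer: "\<And>k A. A \<in> sets (F k) \<Longrightarrow>
          (\<integral>\<^sup>+w. indicator A w * b k w \<partial>M) = (\<integral>\<^sup>+w. indicator A w * a k w \<partial>M)"
    and bound: "\<And>N n w. (\<Sum>k<n. if S k w \<le> of_nat N then a k w else 0) \<le> of_nat N + C"
    and C: "C < \<infinity>" and M: "emeasure M (space M) < \<infinity>"
    and fin: "AE w in M. \<exists>N. \<forall>k. S k w \<le> of_nat N"
  shows "AE w in M. (\<Sum>k. b k w) < \<infinity>"
proof -
  \<comment> \<open>The event of not being stopped at level \<open>N\<close>. It belongs to
    \<open>F k\<close>, so \<open>transfer\<close> applies to it.\<close>
  define A where "A = (\<lambda>N k. {w \<in> space M. S k w \<le> of_nat N})"
  have A: "A N k \<in> sets (F k)" for N k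
  proof -
    have "{w \<in> space (F k). S k w \<le> of_nat N} \<in> sets (F k)"
      using S[of k] by measurable
    then show ?thesis using sub[of k] by (simp add: A_def subalgebra_def)
  qed
  have AM [measurable]: "A N k \<in> sets M" for N k
    using A[of N k] sub[of k] by (auto simp: subalgebra_def)
  note [measurable] = a b
  have "AE w in M. (\<Sum>k. indicator (A N k) w * b k w) \<noteq> \<infinity>" for N
  proof (rule nn_integral_PInf_AE)
    have "(\<integral>\<^sup>+w. (\<Sum>k. indicator (A N k) w * b k w) \<partial>M) = (\<Sum>k. \<integral>\<^sup>+w. indicator (A N k) w * b k w \<partial>M)"
      by (intro nn_integral_suminf) measurable
    also have "\<dots> = (\<Sum>k. \<integral>\<^sup>+w. indicator (A N k) w * a k w \<partial>M)"
      by (simp add: transfer[OF A])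
    also have "\<dots> = (\<integral>\<^sup>+w. (\<Sum>k. indicator (A N k) w * a k w) \<partial>M)"
      by (intro nn_integral_suminf[symmetric]) measurable
    also have "\<dots> \<le> (\<integral>\<^sup>+w. of_nat N + C \<partial>M)"
    proof (intro nn_integral_mono)
      fix w assume "w \<in> space M"
      then have "indicator (A N k) w * a k w = (if S k w \<le> of_nat N then a k w else 0)" for k
        by (simp add: A_def indicator_def)
      then show "(\<Sum>k. indicator (A N k) w * a k w) \<le> of_nat N + C"
        using bound[of w N] by (simp add: suminf_eq_SUP SUP_least)
    qed
    also have "\<dots> = (of_nat N + C) * emeasure M (space M)"
      by simp
    also have "\<dots> < \<infinity>"
      using C M by (simp add: ennreal_mult_less_top of_nat_less_top)
    finally show "(\<integral>\<^sup>+w. (\<Sum>k. indicator (A N k) w * b k w) \<partial>M) \<noteq> \<infinity>" by simp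
  qed measurable
  then have "AE w in M. \<forall>N. (\<Sum>k. indicator (A N k) w * b k w) \<noteq> \<infinity>"
    by (simp add: AE_all_countable)
  with fin AE_space show ?thesis
  proof eventually_elim
    case (elim w)
    then obtain N where "\<forall>k. S k w \<le> of_nat N" by blast
    then have "indicator (A N k) w * b k w = b k w" for k
      using elim by (simp add: A_def)
    then show ?case using elim(3) by (auto simp: less_top dest!: spec[of _ N])
  qed
qed

lemma ennreal_partial_sums_bounded:
  fixes a :: "nat \<Rightarrow> ennreal"
  assumes "(\<Sum>k. a k) < \<infinity>"
  shows "\<exists>N. \<forall>J. finite J \<longrightarrow> sum a J \<le> of_nat N"
proof -
  obtain N where "(\<Sum>k. a k) < of_nat N"
    using ennreal_Ex_less_of_nat[of "\<Sum>k. a k"] assms by auto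
  then have "sum a J \<le> of_nat N" if "finite J" for J
    using sum_le_suminf[of a J] that by (auto intro: order_trans)
  then show ?thesis by blast
qed

section \<open>Conditional summability and independent selection\<close>

context prob_space
begin

lemma subalgebra_sigma_finite: "subalgebra M F \<Longrightarrow> sigma_finite_subalgebra M F"
  by (intro finite_measure_subalgebra_is_sigma_finite finite_measure_subalgebra.intro
      finite_measure_subalgebra_axioms.intro finite_measure_axioms)

lemma nn_cond_exp_indicator_integral:
  assumes "subalgebra M F" "A \<in> sets F" "Y \<in> borel_measurable M"
  shows "(\<integral>\<^sup>+w. indicator A w * nn_cond_exp M F Y w \<partial>M) = (\<integral>\<^sup>+w. indicator A w * Y w \<partial>M)"
  using assms by (intro sigma_finite_subalgebra.nn_cond_exp_intg subalgebra_sigma_finite) auto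

text \<open>One half of Levy's extension of the Borel-Cantelli lemma. The conditional expectation of
  \<open>Y k\<close> is known at time \<open>k\<close>, so the stopping test may include it and
  there is no overshoot: \<open>C = 0\<close>.\<close>

lemma AE_suminf_finite_if_cond:
  fixes Y :: "nat \<Rightarrow> 'a \<Rightarrow> ennreal"
  assumes sub: "\<And>k. subalgebra M (F k)"
    and mono: "\<And>k. sets (F k) \<subseteq> sets (F (Suc k))"
    and Y: "\<And>k. Y k \<in> borel_measurable M"
    and fin: "AE w in M. (\<Sum>k. nn_cond_exp M (F k) (Y k) w) < \<infinity>"
  shows "AE w in M. (\<Sum>k. Y k w) < \<infinity>"
proof (rule AE_suminf_finite_transfer[OF sub, where C = 0 and a = "\<lambda>k. nn_cond_exp M (F k) (Y k)"
      and S = "\<lambda>k w. \<Sum>l\<le>k. nn_cond_exp M (F l) (Y l) w"])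
  have "subalgebra (F k) (F l)" if "l \<le> k" for k l
    using lift_Suc_mono_le[of "\<lambda>k. sets (F k)", OF mono that] sub
    by (auto simp: subalgebra_def)
  then show "(\<lambda>w. \<Sum>l\<le>k. nn_cond_exp M (F l) (Y l) w) \<in> borel_measurable (F k)" for k
    by (intro borel_measurable_sum measurable_from_subalg[OF _ borel_measurable_nn_cond_exp]) auto
  show "AE w in M. \<exists>N. \<forall>k. (\<Sum>l\<le>k. nn_cond_exp M (F l) (Y l) w) \<le> of_nat N"
    using fin by eventually_elim (use ennreal_partial_sums_bounded in blast)
qed (auto simp: Y sub nn_cond_exp_indicator_integral stopped_sum_le emeasure_space_1)

text \<open>The other half. \<open>Y k\<close> is revealed only at time \<open>Suc k\<close>, so the
  stopping test looks at the terms before \<open>k\<close>, and the uniform bound covers the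
  overshoot.\<close>

lemma AE_cond_suminf_finite_if_bounded:
  fixes Y :: "nat \<Rightarrow> 'a \<Rightarrow> ennreal"
  assumes sub: "\<And>k. subalgebra M (F k)"
    and mono: "\<And>k. sets (F k) \<subseteq> sets (F (Suc k))"
    and Y: "\<And>k. Y k \<in> borel_measurable (F (Suc k))"
    and C: "\<And>k w. Y k w \<le> C" "C < \<infinity>"
    and fin: "AE w in M. (\<Sum>k. Y k w) < \<infinity>"
  shows "AE w in M. (\<Sum>k. nn_cond_exp M (F k) (Y k) w) < \<infinity>"
proof (rule AE_suminf_finite_transfer[OF sub, where C = C and a = Y and S = "\<lambda>k w. \<Sum>l<k. Y l w"])
  have YM: "Y k \<in> borel_measurable M" for k
    using measurable_from_subalg[OF sub Y] .
  have "subalgebra (F k) (F (Suc l))" if "l < k" for k l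
    using lift_Suc_mono_le[of "\<lambda>k. sets (F k)" "Suc l" k, OF mono] that sub
    by (auto simp: subalgebra_def)
  then show "(\<lambda>w. \<Sum>l<k. Y l w) \<in> borel_measurable (F k)" for k
    using Y by (intro borel_measurable_sum) (auto intro: measurable_from_subalg)
  show "Y k \<in> borel_measurable M" for k by (rule YM)
  show "(\<integral>\<^sup>+w. indicator A w * nn_cond_exp M (F k) (Y k) w \<partial>M) = (\<integral>\<^sup>+w. indicator A w * Y k w \<partial>M)"
    if "A \<in> sets (F k)" for A k
    by (rule nn_cond_exp_indicator_integral[OF sub that YM])
  show "(\<Sum>k<n. if (\<Sum>l<k. Y l w) \<le> of_nat N then Y k w else 0) \<le> of_nat N + C" for N n w
    by (rule stopped_sum_le_overshoot) (rule C)
  show "AE w in M. \<exists>N. \<forall>k. (\<Sum>l<k. Y l w) \<le> of_nat N"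
    using fin by eventually_elim (use ennreal_partial_sums_bounded in blast)
qed (use C in \<open>auto simp: emeasure_space_1\<close>)

lemma nn_cond_exp_weighted_sum:
  assumes sub: "subalgebra M F" and "finite J"
    and h: "\<And>j. h j \<in> borel_measurable M"
  shows "AE w in M. nn_cond_exp M F (\<lambda>w. \<Sum>j\<in>J. m j * h j w) w
           = (\<Sum>j\<in>J. m j * nn_cond_exp M F (h j) w)"
  using \<open>finite J\<close>
proof induction
  interpret sigma_finite_subalgebra M F by (rule subalgebra_sigma_finite[OF sub])
  note [measurable] = h
  case empty
  show ?case using nn_cond_exp_F_meas[of "\<lambda>_. 0"] by (auto elim: eventually_mono)
next
  interpret sigma_finite_subalgebra M F by (rule subalgebra_sigma_finite[OF sub])
  note [measurable] = h
  case (insert j J)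
  have "AE w in M. nn_cond_exp M F (\<lambda>w. m j * h j w) w
      + nn_cond_exp M F (\<lambda>w. \<Sum>j\<in>J. m j * h j w) w
      = nn_cond_exp M F (\<lambda>w. m j * h j w + (\<Sum>j\<in>J. m j * h j w)) w"
    by (rule nn_cond_exp_sum) measurable
  moreover have "AE w in M. m j * nn_cond_exp M F (h j) w = nn_cond_exp M F (\<lambda>w. m j * h j w) w"
    by (rule nn_cond_exp_prod) measurable
  ultimately show ?case using insert.IH
    by eventually_elim (use insert.hyps in simp)
qed

text \<open>Split by the value of \<open>sel\<close>: \<open>a i\<close> is
  \<open>F\<close>-measurable and can be pulled out, and what remains is the conditional probability
  of \<open>sel w = i\<close>, a constant by independence.\<close>

lemma nn_cond_exp_independent_choice:
  fixes sel :: "'a \<Rightarrow> 'p::finite" and a :: "'p \<Rightarrow> 'a \<Rightarrow> ennreal"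
  assumes sub: "subalgebra M F"
    and sel [measurable]: "sel \<in> measurable M (count_space UNIV)"
    and indep: "indep_set (sets F) {sel -` A \<inter> space M | A. A \<in> UNIV}"
    and a: "\<And>i. a i \<in> borel_measurable F"
  shows "AE w in M. nn_cond_exp M F (\<lambda>w. a (sel w) w) w
           = (\<Sum>i\<in>UNIV. ennreal (prob {w \<in> space M. sel w = i}) * a i w)"
proof -
  interpret sigma_finite_subalgebra M F by (rule subalgebra_sigma_finite[OF sub])
  define E where "E = (\<lambda>i. {w \<in> space M. sel w = i})"
  have E [measurable]: "E i \<in> events" for i unfolding E_def by measurable
  have aM [measurable]: "a i \<in> borel_measurable M" for i
    using measurable_from_subalg[OF sub a] .
  have prob_E: "AE w in M. ennreal (prob (E i)) = nn_cond_exp M F (indicator (E i)) w" for i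
  proof (rule nn_cond_exp_charact)
    fix A assume A: "A \<in> sets F"
    then have [measurable]: "A \<in> events" using sub by (auto simp: subalgebra_def)
    have "E i = sel -` {i} \<inter> space M" by (auto simp: E_def)
    then have *: "prob (A \<inter> E i) = prob A * prob (E i)"
      by (intro indep_setD[OF indep A]) auto
    have "(\<integral>\<^sup>+w\<in>A. indicator (E i) w \<partial>M) = emeasure M (A \<inter> E i)"
      by (simp add: indicator_inter_arith[symmetric] Int_commute)
    also have "\<dots> = ennreal (prob (E i)) * emeasure M A"
      by (simp add: * emeasure_eq_measure ennreal_mult mult.commute)
    also have "\<dots> = (\<integral>\<^sup>+w\<in>A. ennreal (prob (E i)) \<partial>M)"
      by (rule nn_integral_cmult_indicator[symmetric]) measurable
    finally show "(\<integral>\<^sup>+w\<in>A. indicator (E i) w \<partial>M) = (\<integral>\<^sup>+w\<in>A. ennreal (prob (E i)) \<partial>M)" .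
  qed auto
  have "AE w in M. ennreal (prob (E i)) * a i w
      = nn_cond_exp M F (\<lambda>w. a i w * indicator (E i) w) w" for i
    using prob_E[of i] nn_cond_exp_prod[OF a[of i], of "indicator (E i)"]
    by (auto simp: mult.commute)
  then have "AE w in M. \<forall>i. ennreal (prob (E i)) * a i w
      = nn_cond_exp M F (\<lambda>w. a i w * indicator (E i) w) w"
    by (simp add: AE_all_countable)
  moreover have "AE w in M. nn_cond_exp M F (\<lambda>w. \<Sum>i\<in>UNIV. 1 * (a i w * indicator (E i) w)) w
      = (\<Sum>i\<in>UNIV. 1 * nn_cond_exp M F (\<lambda>w. a i w * indicator (E i) w) w)"
    by (rule nn_cond_exp_weighted_sum[OF sub]) auto
  moreover have "AE w in M. nn_cond_exp M F (\<lambda>w. a (sel w) w) w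
      = nn_cond_exp M F (\<lambda>w. \<Sum>i\<in>UNIV. 1 * (a i w * indicator (E i) w)) w"
  proof (rule nn_cond_exp_cong)
    have eq: "a (sel w) w = (\<Sum>i\<in>UNIV. 1 * (a i w * indicator (E i) w))" if "w \<in> space M" for w
      using that by (simp add: E_def indicator_def if_distrib cong: if_cong)
    then show "AE w in M. a (sel w) w = (\<Sum>i\<in>UNIV. 1 * (a i w * indicator (E i) w))"
      by (intro AE_I2)
    show "(\<lambda>w. a (sel w) w) \<in> borel_measurable M"
      by (subst measurable_cong[OF eq]) measurable
  qed measurable
  ultimately show ?thesis
    by eventually_elim (simp add: E_def)
qed

end

section \<open>The relaxed best-response scheme\<close>

locale relaxed_best_response_scheme =
  smooth_potential_game own X g G P L c Mb + prob_space M
  for own :: "'d::finite \<Rightarrow> 'p::finite"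
    and X :: "'p \<Rightarrow> (real ^ 'd) set"
    and g :: "'p \<Rightarrow> real ^ 'd \<Rightarrow> real"
    and G :: "'p \<Rightarrow> real ^ 'd \<Rightarrow> real ^ 'd"
    and P :: "real ^ 'd \<Rightarrow> real"
    and L c :: real
    and Mb :: "'p \<Rightarrow> real"
    and M :: "'w measure" +
  fixes Pmin :: real
    and p :: "'p \<Rightarrow> real"
    and \<gamma> :: "nat \<Rightarrow> real"
    and x z \<epsilon> :: "nat \<Rightarrow> 'w \<Rightarrow> real ^ 'd"
    and sel :: "nat \<Rightarrow> 'w \<Rightarrow> 'p"
    and Fk Fsel :: "nat \<Rightarrow> 'w measure"
  assumes P_ge: "\<And>y. y \<in> feas \<Longrightarrow> Pmin \<le> P y"
    and p_pos: "\<And>i. 0 < p i"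
    and \<gamma>_nonneg: "\<And>k. 0 \<le> \<gamma> k"
    and sub: "\<And>k. subalgebra M (Fk k)" "\<And>k. subalgebra M (Fsel k)"
    and Fk_Fsel: "\<And>k. sets (Fk k) \<subseteq> sets (Fsel k)"
    and Fsel_Suc: "\<And>k. sets (Fsel k) \<subseteq> sets (Fk (Suc k))"
    and sel: "\<And>k. sel k \<in> measurable (Fsel k) (count_space UNIV)"
    and sel_prob: "\<And>k i. prob {w \<in> space M. sel k w = i} = p i"
    and sel_indep: "\<And>k. indep_set (sets (Fk k)) {sel k -` A \<inter> space M | A. A \<in> UNIV}"
    and x_adapted: "\<And>k. x k \<in> borel_measurable (Fk k)"
    and x_feas: "\<And>k w. w \<in> space M \<Longrightarrow> x k w \<in> feas"
    and z_feas: "\<And>k w. w \<in> space M \<Longrightarrow> z (Suc k) w \<in> feas"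
    and z_sel: "\<And>k w i. w \<in> space M \<Longrightarrow> i = sel k w \<Longrightarrow>
          block own i (z (Suc k) w) = (1 - \<gamma> k) *\<^sub>R block own i (x k w) + \<gamma> k *\<^sub>R B i (x k w)"
    and z_unsel: "\<And>k w i. w \<in> space M \<Longrightarrow> i \<noteq> sel k w \<Longrightarrow>
          block own i (z (Suc k) w) = block own i (x k w)"
    and x_step: "\<And>k w. w \<in> space M \<Longrightarrow> x (Suc k) w = z (Suc k) w + \<epsilon> (Suc k) w"
begin

text \<open>The decrease of the potential guaranteed when player \<open>i\<close> moves. It is
  defined for all players, since averaging over the selection also involves those not drawn.\<close>

definition dec :: "nat \<Rightarrow> 'p \<Rightarrow> 'w \<Rightarrow> real" where
  "dec k i w = \<gamma> k * (c - L * \<gamma> k / 2) * (norm (resid i (x k w)))\<^sup>2"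

definition noise :: "nat \<Rightarrow> 'w \<Rightarrow> real" where
  "noise k w = (\<Sum>j\<in>UNIV. Mb j * norm (block own j (\<epsilon> (Suc k) w)))"

lemma Mb_nonneg': "0 \<le> Mb j"
  using not_empty x_feas Mb_nonneg by blast

lemma noise_nonneg: "0 \<le> noise k w"
  unfolding noise_def by (intro sum_nonneg mult_nonneg_nonneg Mb_nonneg') simp

lemma subalgebra_Fk_Fsel: "subalgebra (Fsel k) (Fk k)"
  and subalgebra_Fsel_Suc: "subalgebra (Fk (Suc k)) (Fsel k)"
  using sub Fk_Fsel Fsel_Suc by (auto simp: subalgebra_def)

lemma Fk_Suc: "sets (Fk k) \<subseteq> sets (Fk (Suc k))"
  using Fk_Fsel Fsel_Suc by (rule order_trans)

lemma x_measurable [measurable]: "x k \<in> borel_measurable M"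
  by (rule measurable_from_subalg[OF sub(1) x_adapted])

lemma sel_measurable [measurable]: "sel k \<in> measurable M (count_space UNIV)"
  by (rule measurable_from_subalg[OF sub(2) sel])

lemma measurable_x_comp:
  fixes h :: "real ^ 'd \<Rightarrow> 'b::topological_space"
  assumes "continuous_on feas h"
  shows "(\<lambda>w. h (x k w)) \<in> borel_measurable (Fk k)"
  using assms x_adapted
  by (rule measurable_feas) (use sub x_feas in \<open>auto simp: subalgebra_def\<close>)

lemma P_x_measurable [measurable]: "(\<lambda>w. P (x k w)) \<in> borel_measurable (Fk k)"
  by (rule measurable_x_comp[OF continuous_on_P])

lemma resid_x_measurable [measurable]: "(\<lambda>w. resid i (x k w)) \<in> borel_measurable (Fk k)"
  by (rule measurable_x_comp[OF continuous_on_resid])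

lemma dec_measurable [measurable]: "dec k i \<in> borel_measurable (Fk k)"
  unfolding dec_def[abs_def] by measurable

lemma z_block:
  assumes "w \<in> space M"
  shows "block own j (z (Suc k) w) =
    (if j = sel k w then block own j (x k w) + \<gamma> k *\<^sub>R resid j (x k w) else block own j (x k w))"
  using z_sel[OF assms] z_unsel[OF assms] by (auto simp: resid_def algebra_simps)

text \<open>Measurability of the errors has to be derived: solving the recursion for them expresses
  them by measurable quantities. The same formula later bounds the movement of each block.\<close>

lemma \<epsilon>_block:
  assumes "w \<in> space M"
  shows "block own j (\<epsilon> (Suc k) w) = block own j (x (Suc k) w) - block own j (x k w)
           - (if j = sel k w then \<gamma> k *\<^sub>R resid j (x k w) else 0)"
  using z_block[OF assms, of j k] x_step[OF assms, of k] by (auto simp: block_add)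

lemma \<epsilon>_measurable: "(\<lambda>w. block own j (\<epsilon> (Suc k) w)) \<in> borel_measurable M"
proof -
  have [measurable]: "(\<lambda>w. resid j (x k w)) \<in> borel_measurable M"
    by (rule measurable_from_subalg[OF sub(1) resid_x_measurable])
  show ?thesis by (subst measurable_cong[OF \<epsilon>_block]) measurable
qed

lemma noise_measurable: "noise k \<in> borel_measurable M"
proof -
  note [measurable] = \<epsilon>_measurable
  show ?thesis unfolding noise_def[abs_def] by measurable
qed

text \<open>The first part protects the passage to \<open>ennreal\<close>, which truncates at 0; it
  holds because \<open>z\<close> is feasible, so that \<open>P\<close> is at least
  \<open>Pmin\<close> there. The second charges the move from \<open>z\<close> to the new iterate to
  the noise, which is its weighted length.\<close>

lemma step:
  assumes w: "w \<in> space M"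
  shows "0 \<le> P (x k w) - Pmin - dec k (sel k w) w"
    and "P (x (Suc k) w) - Pmin \<le> (P (x k w) - Pmin - dec k (sel k w) w) + noise k w"
proof -
  let ?i = "sel k w" and ?z = "z (Suc k) w"
  let ?v = "block own ?i (x k w) + \<gamma> k *\<^sub>R resid ?i (x k w)"
  have v: "block own ?i ?z = ?v" using z_block[OF w, of ?i k] by simp
  have z: "?z = repl own ?i ?v (x k w)"
    using repl_eqI[of ?i own ?z "x k w"] z_unsel[OF w] v by metis
  have "?v \<in> X ?i" using feas_block[OF z_feas[OF w]] v by metis
  then have P_z: "P ?z \<le> P (x k w) - dec k ?i w"
    using descent[OF x_feas[OF w] _ \<gamma>_nonneg] unfolding z dec_def by blast
  then show "0 \<le> P (x k w) - Pmin - dec k ?i w"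
    using P_ge[OF z_feas[OF w], of k] by linarith
  have "wdist (x (Suc k) w) ?z = noise k w"
    unfolding wdist_def noise_def by (simp add: x_step[OF w] block_add)
  then show "P (x (Suc k) w) - Pmin \<le> (P (x k w) - Pmin - dec k ?i w) + noise k w"
    using P_wdist[OF z_feas[OF w, of k] x_feas[OF w, of "Suc k"]] P_z by linarith
qed

lemma noise_cond_expect:
  assumes F: "subalgebra M F"
  shows "AE w in M. enn2ereal (nn_cond_exp M F (\<lambda>w. ennreal (noise k w)) w) =
    (\<Sum>j\<in>UNIV. ereal (Mb j) * cond_expect M F (\<lambda>v. norm (block own j (\<epsilon> (Suc k) v))) w)"
proof -
  note [measurable] = \<epsilon>_measurable
  have 1: "(\<lambda>w. ennreal (noise k w)) = (\<lambda>w. \<Sum>j\<in>UNIV. ennreal (Mb j) * ennreal (norm (block own j (\<epsilon> (Suc k) w))))"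
    unfolding noise_def by (simp add: sum_ennreal Mb_nonneg' flip: ennreal_mult)
  have 2: "AE w in M. nn_cond_exp M F (\<lambda>w. \<Sum>j\<in>UNIV. ennreal (Mb j) * ennreal (norm (block own j (\<epsilon> (Suc k) w)))) w
      = (\<Sum>j\<in>UNIV. ennreal (Mb j) * nn_cond_exp M F (\<lambda>w. ennreal (norm (block own j (\<epsilon> (Suc k) w)))) w)"
    by (rule nn_cond_exp_weighted_sum[OF F]) auto
  have 3: "enn2ereal (\<Sum>j\<in>UNIV. ennreal (Mb j) * nn_cond_exp M F (\<lambda>w. ennreal (norm (block own j (\<epsilon> (Suc k) w)))) w)
     = (\<Sum>j\<in>UNIV. ereal (Mb j) * cond_expect M F (\<lambda>v. norm (block own j (\<epsilon> (Suc k) v))) w)" for w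
    by (simp add: cond_expect_def Mb_nonneg' times_ennreal.rep_eq enn2ereal_ennreal flip: sum_enn2ereal)
  from 2 show ?thesis by eventually_elim (simp only: 1 3)
qed

text \<open>Kept for an arbitrary sub-sigma-algebra, to be used with \<open>Fsel k\<close>, where
  the selected player is known, and with \<open>Fk k\<close>, where it is averaged out.\<close>

lemma cond_step:
  assumes F: "subalgebra M F"
  shows "AE w in M. nn_cond_exp M F (\<lambda>v. ennreal (P (x (Suc k) v) - Pmin)) w
    \<le> nn_cond_exp M F (\<lambda>v. ennreal (P (x k v) - Pmin - dec k (sel k v) v)) w
      + nn_cond_exp M F (\<lambda>v. ennreal (noise k v)) w"
proof -
  interpret sigma_finite_subalgebra M F by (rule subalgebra_sigma_finite[OF F])
  note [measurable] = noise_measurable measurable_from_subalg[OF sub(1) P_x_measurable]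
    measurable_from_subalg[OF sub(1) dec_measurable]
  have "AE w in M. nn_cond_exp M F (\<lambda>v. ennreal (P (x (Suc k) v) - Pmin)) w
    \<le> nn_cond_exp M F (\<lambda>v. ennreal (P (x k v) - Pmin - dec k (sel k v) v) + ennreal (noise k v)) w"
  proof (rule nn_cond_exp_mono)
    show "AE v in M. ennreal (P (x (Suc k) v) - Pmin)
        \<le> ennreal (P (x k v) - Pmin - dec k (sel k v) v) + ennreal (noise k v)"
    proof (rule AE_I2)
      fix v assume "v \<in> space M"
      from step[OF this] show "ennreal (P (x (Suc k) v) - Pmin)
        \<le> ennreal (P (x k v) - Pmin - dec k (sel k v) v) + ennreal (noise k v)"
        by (simp add: noise_nonneg flip: ennreal_plus)
    qed
  qed measurable
  moreover have "AE w in M. nn_cond_exp M F (\<lambda>v. ennreal (P (x k v) - Pmin - dec k (sel k v) v)) w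
      + nn_cond_exp M F (\<lambda>v. ennreal (noise k v)) w
    = nn_cond_exp M F (\<lambda>v. ennreal (P (x k v) - Pmin - dec k (sel k v) v) + ennreal (noise k v)) w"
    by (rule nn_cond_exp_sum) measurable
  ultimately show ?thesis by eventually_elim simp
qed

text \<open>Relative to \<open>Fk k\<close> the selected player is still random, so a bound with the
  residual of that player is stated relative to \<open>Fsel k\<close>. There
  \<open>dec k (sel k w) w\<close> is measurable, and conditioning leaves it unchanged.\<close>

lemma cond_descent_sel:
  "AE w in M. sel k w = i \<longrightarrow>
     cond_expect M (Fsel k) (\<lambda>v. P (x (Suc k) v) - Pmin) w
     \<le> ereal ((P (x k w) - Pmin) - dec k i w)
       + (\<Sum>j\<in>UNIV. ereal (Mb j) * cond_expect M (Fsel k) (\<lambda>v. norm (block own j (\<epsilon> (Suc k) v))) w)"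
proof -
  interpret sigma_finite_subalgebra M "Fsel k" by (rule subalgebra_sigma_finite[OF sub(2)])
  note [measurable] = sel measurable_from_subalg[OF subalgebra_Fk_Fsel P_x_measurable]
    measurable_from_subalg[OF subalgebra_Fk_Fsel dec_measurable]
  have "AE w in M. ennreal (P (x k w) - Pmin - dec k (sel k w) w)
      = nn_cond_exp M (Fsel k) (\<lambda>v. ennreal (P (x k v) - Pmin - dec k (sel k v) v)) w"
    by (rule nn_cond_exp_F_meas) measurable
  with cond_step[OF sub(2)[of k], of k] noise_cond_expect[OF sub(2)[of k], of k] AE_space show ?thesis
  proof eventually_elim
    case (elim w)
    then have "nn_cond_exp M (Fsel k) (\<lambda>v. ennreal (P (x (Suc k) v) - Pmin)) w
      \<le> ennreal (P (x k w) - Pmin - dec k (sel k w) w)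
        + nn_cond_exp M (Fsel k) (\<lambda>v. ennreal (noise k v)) w" by simp
    then have "enn2ereal (nn_cond_exp M (Fsel k) (\<lambda>v. ennreal (P (x (Suc k) v) - Pmin)) w)
      \<le> ereal (P (x k w) - Pmin - dec k (sel k w) w)
        + enn2ereal (nn_cond_exp M (Fsel k) (\<lambda>v. ennreal (noise k v)) w)"
      using step(1)[OF elim(3)] by (simp add: less_eq_ennreal.rep_eq plus_ennreal.rep_eq enn2ereal_ennreal)
    then show ?case
      unfolding elim(2) by (auto simp: cond_expect_def)
  qed
qed

text \<open>The feasibility of \<open>z\<close> gives the bound for the selected player only.  Since every player
  is selected with positive probability independently of \<open>x k\<close>, it holds for all players.\<close>

lemma AE_dec_le: "AE w in M. \<forall>i. dec k i w \<le> P (x k w) - Pmin"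
proof -
  have "AE w in M. dec k i w \<le> P (x k w) - Pmin" for i
  proof -
    define A where "A = {w \<in> space M. \<not> dec k i w \<le> P (x k w) - Pmin}"
    have "space M = space (Fk k)" using sub(1)[of k] by (simp add: subalgebra_def)
    then have A: "A \<in> sets (Fk k)" unfolding A_def by simp
    have eq: "{w \<in> space M. sel k w = i} = sel k -` {i} \<inter> space M" by auto
    have "prob (A \<inter> {w \<in> space M. sel k w = i}) = prob A * p i"
      unfolding sel_prob[of k i, symmetric] eq by (rule indep_setD[OF sel_indep A]) auto
    moreover have "A \<inter> {w \<in> space M. sel k w = i} = {}"
      using step(1)[of _ k] by (auto simp: A_def)
    ultimately have "prob A = 0" using p_pos[of i] by simp
    then have "A \<in> null_sets M"
      using A sub(1)[of k] by (intro null_setsI) (auto simp: subalgebra_def emeasure_eq_measure)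
    then show ?thesis by (rule AE_I') (auto simp: A_def)
  qed
  then show ?thesis by (simp add: AE_all_countable)
qed

lemma sum_p: "(\<Sum>i\<in>UNIV. p i) = 1"
proof -
  have "(\<Sum>i\<in>UNIV. prob {w \<in> space M. sel k w = i}) = prob (\<Union>i. {w \<in> space M. sel k w = i})" for k
    by (rule finite_measure_finite_Union[symmetric]) (auto simp: disjoint_family_on_def)
  moreover have "(\<Union>i. {w \<in> space M. sel k w = i}) = space M" for k by auto
  ultimately show ?thesis by (simp add: sel_prob prob_space)
qed

lemma cond_descent_avg:
  "AE w in M. cond_expect M (Fk k) (\<lambda>v. P (x (Suc k) v) - Pmin) w
     \<le> ereal ((P (x k w) - Pmin) - (\<Sum>i\<in>UNIV. p i * dec k i w))
       + (\<Sum>j\<in>UNIV. ereal (Mb j) * cond_expect M (Fk k) (\<lambda>v. norm (block own j (\<epsilon> (Suc k) v))) w)"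
proof -
  have "AE w in M. nn_cond_exp M (Fk k) (\<lambda>v. ennreal (P (x k v) - Pmin - dec k (sel k v) v)) w
      = (\<Sum>i\<in>UNIV. ennreal (prob {w \<in> space M. sel k w = i}) * ennreal (P (x k w) - Pmin - dec k i w))"
    by (rule nn_cond_exp_independent_choice[OF sub(1) _ sel_indep]) measurable
  with cond_step[OF sub(1)[of k], of k] noise_cond_expect[OF sub(1)[of k], of k] AE_dec_le[of k] show ?thesis
  proof eventually_elim
    case (elim w)
    \<comment> \<open>\<open>AE_dec_le\<close> makes every difference nonnegative, so that the sum
      can be taken inside \<open>ennreal\<close>.\<close>
    have "(\<Sum>i\<in>UNIV. ennreal (prob {w \<in> space M. sel k w = i}) * ennreal (P (x k w) - Pmin - dec k i w))
        = ennreal (\<Sum>i\<in>UNIV. p i * (P (x k w) - Pmin - dec k i w))"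
      using elim(3) p_pos by (simp add: sel_prob sum_ennreal less_imp_le flip: ennreal_mult)
    also have "(\<Sum>i\<in>UNIV. p i * (P (x k w) - Pmin - dec k i w))
        = P (x k w) - Pmin - (\<Sum>i\<in>UNIV. p i * dec k i w)"
      by (simp add: right_diff_distrib sum_subtractf sum_p flip: sum_distrib_right)
    finally have "nn_cond_exp M (Fk k) (\<lambda>v. ennreal (P (x (Suc k) v) - Pmin)) w
      \<le> ennreal (P (x k w) - Pmin - (\<Sum>i\<in>UNIV. p i * dec k i w))
        + nn_cond_exp M (Fk k) (\<lambda>v. ennreal (noise k v)) w" using elim by simp
    moreover have "(\<Sum>i\<in>UNIV. p i * dec k i w) \<le> (\<Sum>i\<in>UNIV. p i * (P (x k w) - Pmin))"
      using elim(3) p_pos by (intro sum_mono mult_left_mono) (auto simp: less_imp_le)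
    then have "(\<Sum>i\<in>UNIV. p i * dec k i w) \<le> P (x k w) - Pmin"
      by (simp add: sum_p flip: sum_distrib_right)
    ultimately have "enn2ereal (nn_cond_exp M (Fk k) (\<lambda>v. ennreal (P (x (Suc k) v) - Pmin)) w)
      \<le> ereal (P (x k w) - Pmin - (\<Sum>i\<in>UNIV. p i * dec k i w))
        + enn2ereal (nn_cond_exp M (Fk k) (\<lambda>v. ennreal (noise k v)) w)"
      by (simp add: less_eq_ennreal.rep_eq plus_ennreal.rep_eq enn2ereal_ennreal)
    then show ?case
      unfolding elim(2) by (simp add: cond_expect_def)
  qed
qed

section \<open>Summability of errors and decreases along almost every path\<close>

lemma AE_noise_summable:
  assumes "AE w in M. (\<Sum>k. \<Sum>j\<in>UNIV. ereal (Mb j) *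
      cond_expect M (Fk k) (\<lambda>v. norm (block own j (\<epsilon> (Suc k) v))) w) < \<infinity>"
  shows "AE w in M. summable (\<lambda>k. noise k w)"
proof -
  have "AE w in M. \<forall>k. enn2ereal (nn_cond_exp M (Fk k) (\<lambda>w. ennreal (noise k w)) w) =
    (\<Sum>j\<in>UNIV. ereal (Mb j) * cond_expect M (Fk k) (\<lambda>v. norm (block own j (\<epsilon> (Suc k) v))) w)"
    using noise_cond_expect[OF sub(1)] by (simp add: AE_all_countable)
  with assms have "AE w in M. (\<Sum>k. nn_cond_exp M (Fk k) (\<lambda>w. ennreal (noise k w)) w) < \<infinity>"
  proof eventually_elim
    case (elim w)
    have "enn2ereal (\<Sum>k. nn_cond_exp M (Fk k) (\<lambda>w. ennreal (noise k w)) w)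
        = (\<Sum>k. enn2ereal (nn_cond_exp M (Fk k) (\<lambda>w. ennreal (noise k w)) w))"
      by (rule suminf_enn2ereal[symmetric])
    also have "\<dots> < \<infinity>" using elim by (simp only:)
    finally have "enn2ereal (\<Sum>k. nn_cond_exp M (Fk k) (\<lambda>w. ennreal (noise k w)) w) < \<infinity>" .
    then show ?case by (simp add: less_ennreal.rep_eq)
  qed
  then have "AE w in M. (\<Sum>k. ennreal (noise k w)) < \<infinity>"
    by (rule AE_suminf_finite_if_cond[where F = Fk, OF sub(1) Fk_Suc, rotated])
      (use noise_measurable in measurable)
  then show ?thesis
    by eventually_elim (auto intro!: summable_suminf_not_top noise_nonneg)
qed

lemma dec_sel_summable:
  assumes w: "w \<in> space M" and e: "summable (\<lambda>k. noise k w)" and pos: "\<And>k i. 0 \<le> dec k i w"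
  shows "summable (\<lambda>k. dec k (sel k w) w)"
proof (rule summableI_nonneg_bounded)
  fix n
  have "P (x n w) - Pmin + (\<Sum>k<n. dec k (sel k w) w) \<le> P (x 0 w) - Pmin + (\<Sum>k<n. noise k w)"
  proof (induction n)
    case (Suc n)
    then show ?case using step(2)[OF w, of n] by simp
  qed simp
  moreover have "(\<Sum>k<n. noise k w) \<le> (\<Sum>k. noise k w)"
    by (rule sum_le_suminf[OF e]) (auto simp: noise_nonneg)
  ultimately show "(\<Sum>k<n. dec k (sel k w) w) \<le> P (x 0 w) - Pmin + (\<Sum>k. noise k w)"
    using P_ge[OF x_feas[OF w, of n]] by linarith
qed (rule pos)

text \<open>A path controls, at each time, only the decrease of the player selected then. The
  conditional expectation of this decrease is the average over all players with weights
  \<open>p i\<close>, and \<open>p i > 0\<close> recovers each of them.\<close>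

lemma AE_dec_summable:
  assumes e: "AE w in M. summable (\<lambda>k. noise k w)"
    and pos: "\<And>k. 0 \<le> c - L * \<gamma> k / 2" and bdd: "\<And>k. \<gamma> k * (c - L * \<gamma> k / 2) \<le> b"
  shows "AE w in M. \<forall>i. summable (\<lambda>k. dec k i w)"
proof -
  have dec_nonneg: "0 \<le> dec k i w" for k i w
    unfolding dec_def by (intro mult_nonneg_nonneg \<gamma>_nonneg pos zero_le_power2)
  define C where "C = (\<Sum>i\<in>UNIV. b * (Mb i / c)\<^sup>2)"
  have b: "0 \<le> b" using bdd[of 0] \<gamma>_nonneg[of 0] pos[of 0] by (auto intro: order_trans[rotated])
  have dec_le: "dec k i w \<le> C" if w: "w \<in> space M" for k i w
  proof -
    have "norm (resid i (x k w)) \<le> Mb i / c"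
      using norm_resid_le[OF x_feas[OF w]] c_pos by (simp add: field_simps)
    then have "dec k i w \<le> b * (Mb i / c)\<^sup>2"
      unfolding dec_def using b \<gamma>_nonneg[of k] pos[of k]
      by (intro mult_mono bdd power_mono) auto
    also have "\<dots> \<le> C"
      unfolding C_def using b by (intro member_le_sum) auto
    finally show ?thesis .
  qed
  \<comment> \<open>The bound by \<open>C\<close> rests on feasibility, known on
    \<open>space M\<close> only, while the lemma to be applied asks for it everywhere; the
    truncation changes nothing on \<open>space M\<close>.\<close>
  define Y where "Y = (\<lambda>k w. min (ennreal (dec k (sel k w) w)) (ennreal C))"
  have Y_eq: "Y k w = ennreal (dec k (sel k w) w)" if "w \<in> space M" for k w
    using dec_le[OF that, of k "sel k w"] by (simp add: Y_def min_absorb1 ennreal_leI)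
  have "AE w in M. (\<Sum>k. Y k w) < \<infinity>"
    using e AE_space
  proof eventually_elim
    case (elim w)
    have "summable (\<lambda>k. dec k (sel k w) w)"
      by (rule dec_sel_summable[OF elim(2,1) dec_nonneg])
    then show ?case
      unfolding Y_eq[OF elim(2)] infinity_ennreal_def less_top[symmetric]
      by (rule ennreal_suminf_neq_top) (rule dec_nonneg)
  qed
  moreover have "Y k \<in> borel_measurable (Fk (Suc k))" for k
  proof -
    note [measurable] = measurable_from_subalg[OF subalgebra_Fsel_Suc sel]
      measurable_from_subalg[OF subalgebra_Fsel_Suc measurable_from_subalg[OF subalgebra_Fk_Fsel dec_measurable]]
    show ?thesis unfolding Y_def by measurable
  qed
  ultimately have "AE w in M. (\<Sum>k. nn_cond_exp M (Fk k) (Y k) w) < \<infinity>"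
    by (intro AE_cond_suminf_finite_if_bounded[where F = Fk and C = "ennreal C", OF sub(1) Fk_Suc])
      (auto simp: Y_def)
  moreover have "AE w in M. \<forall>k. nn_cond_exp M (Fk k) (Y k) w
      = (\<Sum>i\<in>UNIV. ennreal (p i) * min (ennreal (dec k i w)) (ennreal C))"
    unfolding Y_def AE_all_countable
  proof
    fix k
    have "(\<lambda>w. min (ennreal (dec k i w)) (ennreal C)) \<in> borel_measurable (Fk k)" for i
      by measurable
    from nn_cond_exp_independent_choice[OF sub(1) sel_measurable sel_indep this]
    show "AE w in M. nn_cond_exp M (Fk k) (\<lambda>w. min (ennreal (dec k (sel k w) w)) (ennreal C)) w
        = (\<Sum>i\<in>UNIV. ennreal (p i) * min (ennreal (dec k i w)) (ennreal C))"
      by (simp add: sel_prob)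
  qed
  ultimately show ?thesis using AE_space
  proof eventually_elim
    case (elim w)
    have "nn_cond_exp M (Fk k) (Y k) w = ennreal (\<Sum>i\<in>UNIV. p i * dec k i w)" for k
      using elim(2) dec_le[OF elim(3)] dec_nonneg p_pos
      by (simp add: min_absorb1 ennreal_leI sum_ennreal less_imp_le flip: ennreal_mult)
    then have sum: "summable (\<lambda>k. \<Sum>i\<in>UNIV. p i * dec k i w)"
      using elim(1) p_pos dec_nonneg
      by (intro summable_suminf_not_top sum_nonneg) (auto simp: less_imp_le)
    have "summable (\<lambda>k. p i * dec k i w)" for i
    proof (rule summable_comparison_test'[OF sum])
      show "norm (p i * dec k i w) \<le> (\<Sum>i\<in>UNIV. p i * dec k i w)" if "0 \<le> k" for k
        using p_pos dec_nonneg member_le_sum[of i UNIV "\<lambda>i. p i * dec k i w"]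
        by (simp add: abs_mult less_imp_le)
    qed
    then show ?case using p_pos by (simp add: summable_cmult_iff less_imp_neq[symmetric])
  qed
qed

text \<open>The weight \<open>Mb j\<close> times the step length
  \<open>\<gamma> l * (Mb j / c)\<close> produces \<open>(Mb j)\<^sup>2 / c\<close>. Charging this
  for every player makes the bound independent of who is selected.\<close>

lemma wdist_steps:
  assumes w: "w \<in> space M" and km: "k \<le> m"
  shows "wdist (x m w) (x k w) \<le> (\<Sum>l\<in>{k..<m}. (\<Sum>j\<in>UNIV. (Mb j)\<^sup>2 / c) * \<gamma> l + noise l w)"
  using km
proof (induction rule: dec_induct)
  case (step l)
  let ?i = "sel l w"
  have "Mb j * norm (block own j (x (Suc l) w) - block own j (x l w))
      \<le> (Mb j)\<^sup>2 / c * \<gamma> l + Mb j * norm (block own j (\<epsilon> (Suc l) w))" for j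
  proof -
    have "norm (block own j (x (Suc l) w) - block own j (x l w))
        = norm (block own j (\<epsilon> (Suc l) w) + (if j = ?i then \<gamma> l *\<^sub>R resid j (x l w) else 0))"
      by (simp add: \<epsilon>_block[OF w])
    also have "\<dots> \<le> norm (block own j (\<epsilon> (Suc l) w)) + norm (if j = ?i then \<gamma> l *\<^sub>R resid j (x l w) else 0)"
      by (rule norm_triangle_ineq)
    also have "norm (if j = ?i then \<gamma> l *\<^sub>R resid j (x l w) else 0) \<le> \<gamma> l * (Mb j / c)"
    proof -
      have "norm (resid j (x l w)) \<le> Mb j / c"
        using norm_resid_le[OF x_feas[OF w]] c_pos by (simp add: field_simps)
      then have "\<gamma> l * norm (resid j (x l w)) \<le> \<gamma> l * (Mb j / c)"
        by (rule mult_left_mono[OF _ \<gamma>_nonneg])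
      then show ?thesis using c_pos \<gamma>_nonneg[of l] Mb_nonneg'[of j] by auto
    qed
    finally have "Mb j * norm (block own j (x (Suc l) w) - block own j (x l w))
       \<le> Mb j * (norm (block own j (\<epsilon> (Suc l) w)) + \<gamma> l * (Mb j / c))"
      by (intro mult_left_mono Mb_nonneg') simp
    then show ?thesis by (simp add: algebra_simps power2_eq_square)
  qed
  then have "wdist (x (Suc l) w) (x l w)
      \<le> (\<Sum>j\<in>UNIV. (Mb j)\<^sup>2 / c * \<gamma> l + Mb j * norm (block own j (\<epsilon> (Suc l) w)))"
    unfolding wdist_def by (rule sum_mono)
  also have "\<dots> = (\<Sum>j\<in>UNIV. (Mb j)\<^sup>2 / c) * \<gamma> l + noise l w"
    by (simp add: sum.distrib noise_def sum_distrib_right)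
  finally show ?case
    using step wdist_triangle[OF x_feas[OF w, of "Suc l"], of "x k w" "x l w"] by simp
qed simp

lemma resid_tendsto_0:
  assumes w: "w \<in> space M" and e: "summable (\<lambda>k. noise k w)"
    and dec: "summable (\<lambda>k. dec k i w)"
    and \<gamma>: "\<gamma> \<longlonglongrightarrow> 0" "\<not> summable \<gamma>"
  shows "(\<lambda>k. resid i (x k w)) \<longlonglongrightarrow> 0"
proof (rule slowly_varying_tendsto_0[OF \<gamma>_nonneg \<gamma>(2) _ e])
  \<comment> \<open>The weights vanish, so the factor of the decrease eventually exceeds
    \<open>c / 2\<close>; summable decreases then give summability of \<open>\<gamma> k\<close>
    times the squared residual.\<close>
  have "(\<lambda>k. c - L * \<gamma> k / 2) \<longlonglongrightarrow> c - L * 0 / 2"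
    by (intro tendsto_intros \<gamma>) simp
  then have "\<forall>\<^sub>F k in sequentially. c / 2 < c - L * \<gamma> k / 2"
    by (rule order_tendstoD) (use c_pos in simp)
  then have "\<forall>\<^sub>F k in sequentially. norm (c / 2 * (\<gamma> k * (norm (resid i (x k w)))\<^sup>2)) \<le> dec k i w"
  proof eventually_elim
    case (elim k)
    have "c / 2 * (\<gamma> k * (norm (resid i (x k w)))\<^sup>2) \<le> (c - L * \<gamma> k / 2) * (\<gamma> k * (norm (resid i (x k w)))\<^sup>2)"
      using elim \<gamma>_nonneg[of k] by (intro mult_right_mono) auto
    moreover have "norm (c / 2 * (\<gamma> k * (norm (resid i (x k w)))\<^sup>2)) = c / 2 * (\<gamma> k * (norm (resid i (x k w)))\<^sup>2)"
      using c_pos \<gamma>_nonneg[of k] by simp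
    ultimately show ?case by (simp only: dec_def mult_ac)
  qed
  then have "summable (\<lambda>k. c / 2 * (\<gamma> k * (norm (resid i (x k w)))\<^sup>2))"
    using dec by (rule summable_comparison_test_ev)
  then show "summable (\<lambda>k. \<gamma> k * (norm (resid i (x k w)))\<^sup>2)"
    using c_pos by (simp add: summable_cmult_iff)
  show "0 \<le> 2 / c" using c_pos by simp
  show "0 \<le> (\<Sum>j\<in>UNIV. (Mb j)\<^sup>2 / c)" using c_pos by (intro sum_nonneg) simp
  fix k m :: nat assume "k \<le> m"
  have "(norm (resid i (x m w) - resid i (x k w)))\<^sup>2 \<le> 2 / c * wdist (x m w) (x k w)"
    by (rule resid_wdist[OF x_feas[OF w] x_feas[OF w]])
  also have "\<dots> \<le> 2 / c * (\<Sum>l\<in>{k..<m}. (\<Sum>j\<in>UNIV. (Mb j)\<^sup>2 / c) * \<gamma> l + noise l w)"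
    using c_pos by (intro mult_left_mono wdist_steps[OF w \<open>k \<le> m\<close>]) simp
  finally show "(norm (resid i (x m w) - resid i (x k w)))\<^sup>2 \<le>
      2 / c * (\<Sum>l\<in>{k..<m}. (\<Sum>j\<in>UNIV. (Mb j)\<^sup>2 / c) * \<gamma> l + noise l w)" .
qed

lemma sum_resid_tendsto_0:
  assumes "\<And>i. (\<lambda>k. resid i (x k w)) \<longlonglongrightarrow> 0"
  shows "(\<lambda>k. \<Sum>j\<in>UNIV. (norm (block own j (x k w) - B j (x k w)))\<^sup>2) \<longlonglongrightarrow> 0"
proof -
  have "(\<lambda>k. \<Sum>j\<in>UNIV. (norm (resid j (x k w)))\<^sup>2) \<longlonglongrightarrow> (\<Sum>j\<in>(UNIV::'p set). (norm (0::real ^ 'd))\<^sup>2)"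
    by (intro tendsto_intros assms)
  then show ?thesis by (simp add: resid_def norm_minus_commute)
qed

lemma AE_diminishing_steps:
  assumes L: "L > 0" and \<gamma>: "\<not> summable \<gamma>" "summable (\<lambda>k. (\<gamma> k)\<^sup>2)" "\<And>k. \<gamma> k < 2 * c / L"
    and e: "AE w in M. summable (\<lambda>k. noise k w)"
  shows "AE w in M. (\<lambda>k. \<Sum>j\<in>UNIV. (norm (block own j (x k w) - B j (x k w)))\<^sup>2) \<longlonglongrightarrow> 0"
proof -
  have pos: "0 \<le> c - L * \<gamma> k / 2" for k
    using \<gamma>(3)[of k] L by (simp add: field_simps)
  have "\<gamma> k * (c - L * \<gamma> k / 2) \<le> 2 * c / L * c" for k
    using \<gamma>(3)[of k] \<gamma>_nonneg[of k] pos[of k] L c_pos by (intro mult_mono) auto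
  then have dec: "AE w in M. \<forall>i. summable (\<lambda>k. dec k i w)"
    by (rule AE_dec_summable[OF e pos])
  have \<gamma>_0: "\<gamma> \<longlonglongrightarrow> 0"
    using tendsto_real_sqrt[OF summable_LIMSEQ_zero[OF \<gamma>(2)]] \<gamma>_nonneg by simp
  from dec e AE_space show ?thesis
  proof eventually_elim
    case (elim w)
    show ?case
      by (rule sum_resid_tendsto_0, rule resid_tendsto_0) (use elim \<gamma>(1) \<gamma>_0 in auto)
  qed
qed

text \<open>The decrease is now a fixed positive multiple of the squared residual, so the limit
  follows from summability alone, without slow variation.\<close>

lemma AE_unit_steps:
  assumes \<gamma>: "\<And>k. \<gamma> k = 1" and c: "c > L / 2"
    and e: "AE w in M. summable (\<lambda>k. noise k w)"
  shows "AE w in M. (\<lambda>k. \<Sum>j\<in>UNIV. (norm (block own j (x k w) - B j (x k w)))\<^sup>2) \<longlonglongrightarrow> 0"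
proof -
  have "AE w in M. \<forall>i. summable (\<lambda>k. dec k i w)"
    by (rule AE_dec_summable[OF e, of "c - L / 2"]) (use \<gamma> c in auto)
  then show ?thesis
  proof eventually_elim
    case (elim w)
    have "(\<lambda>k. resid i (x k w)) \<longlonglongrightarrow> 0" for i
    proof -
      have "summable (\<lambda>k. (c - L / 2) * (norm (resid i (x k w)))\<^sup>2)"
        using spec[OF elim, of i] by (simp add: dec_def \<gamma>)
      then have "(\<lambda>k. (norm (resid i (x k w)))\<^sup>2) \<longlonglongrightarrow> 0"
        using c by (intro summable_LIMSEQ_zero) (simp add: summable_cmult_iff)
      then show ?thesis by (simp add: tendsto_norm_zero_iff)
    qed
    then show ?case by (rule sum_resid_tendsto_0)
  qed
qed

end

section \<open>The filtrations generated by the scheme\<close>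

lemma
  fixes sel :: "nat \<Rightarrow> 'w \<Rightarrow> 'p"
  assumes x0: "x0 \<in> borel_measurable M"
    and sel: "\<And>k. sel k \<in> measurable M (count_space UNIV)"
    and smp: "\<And>k. smp k \<in> measurable M (S k)"
  shows subalgebra_history: "subalgebra M (history M x0 sel smp S k)"
    and subalgebra_history_sel: "subalgebra M (history_sel M x0 sel smp S k)"
    and history_subset_history_sel:
      "sets (history M x0 sel smp S k) \<subseteq> sets (history_sel M x0 sel smp S k)"
    and history_sel_subset_Suc:
      "sets (history_sel M x0 sel smp S k) \<subseteq> sets (history M x0 sel smp S (Suc k))"
    and sel_measurable_history_sel:
      "sel k \<in> measurable (history_sel M x0 sel smp S k) (count_space UNIV)"
proof -
  define gen where "gen k = {x0 -` A \<inter> space M | A. A \<in> sets borel}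
      \<union> (\<Union>l<k. {sel l -` A \<inter> space M | A. A \<in> UNIV})
      \<union> (\<Union>l<k. {smp l -` A \<inter> space M | A. A \<in> sets (S l)})" for k
  define chosen where "chosen = {sel k -` A \<inter> space M | A. A \<in> UNIV}"
  have chosen: "chosen \<subseteq> sets M"
    unfolding chosen_def using measurable_sets[OF sel] by auto
  have gen: "gen k \<subseteq> sets M" for k
    unfolding gen_def using measurable_sets[OF x0] measurable_sets[OF sel] measurable_sets[OF smp]
    by auto
  have sets_h: "sets (history M x0 sel smp S k) = sigma_sets (space M) (gen k)" for k
    unfolding history_def gen_def[symmetric]
    using gen[of k] sets.space_closed[of M] by (intro sets_measure_of) blast
  have space_h: "space (history M x0 sel smp S k) = space M" for k
    unfolding history_def by (simp add: space_measure_of_conv)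
  have h_sub: "sets (history M x0 sel smp S k) \<subseteq> sets M" for k
    unfolding sets_h by (rule sets.sigma_sets_subset[OF gen])
  have sets_hs: "sets (history_sel M x0 sel smp S k)
      = sigma_sets (space M) (sets (history M x0 sel smp S k) \<union> chosen)"
    unfolding history_sel_def chosen_def[symmetric]
    using h_sub[of k] chosen sets.space_closed[of M] by (intro sets_measure_of) blast
  have space_hs: "space (history_sel M x0 sel smp S k) = space M"
    unfolding history_sel_def by (simp add: space_measure_of_conv)
  show "subalgebra M (history M x0 sel smp S k)"
    using h_sub space_h by (simp add: subalgebra_def)
  show "subalgebra M (history_sel M x0 sel smp S k)"
    unfolding subalgebra_def space_hs sets_hs
    using h_sub chosen by (intro conjI refl sets.sigma_sets_subset) simp
  show "sets (history M x0 sel smp S k) \<subseteq> sets (history_sel M x0 sel smp S k)"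
    unfolding sets_hs by (auto intro: sigma_sets.Basic)
  show "sets (history_sel M x0 sel smp S k) \<subseteq> sets (history M x0 sel smp S (Suc k))"
  proof -
    \<comment> \<open>Iteration \<open>k\<close> contributes the selected player and the samples;
      \<open>chosen\<close> holds the former, which places \<open>history_sel\<close> between two
      successive histories.\<close>
    have "gen (Suc k) = gen k \<union> chosen \<union> {smp k -` A \<inter> space M | A. A \<in> sets (S k)}"
      unfolding gen_def chosen_def lessThan_Suc UN_insert by (simp only: Un_ac)
    then have mono: "gen k \<subseteq> gen (Suc k)" and cS: "chosen \<subseteq> gen (Suc k)"
      by auto
    have "sets (history M x0 sel smp S k) \<union> chosen \<subseteq> sets (history M x0 sel smp S (Suc k))"
      unfolding sets_h using sigma_sets_mono'[OF mono] cS by (auto intro: sigma_sets.Basic)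
    then show ?thesis
      unfolding sets_hs space_h[of "Suc k", symmetric] by (rule sets.sigma_sets_subset)
  qed
  show "sel k \<in> measurable (history_sel M x0 sel smp S k) (count_space UNIV)"
  proof (rule measurableI)
    fix A :: "'p set"
    have "sel k -` A \<inter> space M \<in> chosen" by (auto simp: chosen_def)
    then show "sel k -` A \<inter> space (history_sel M x0 sel smp S k) \<in> sets (history_sel M x0 sel smp S k)"
      unfolding space_hs sets_hs by (intro sigma_sets.Basic) simp
  qed simp
qed

theorem proposition13:
  fixes own :: "'d::finite \<Rightarrow> 'p::finite"
    and X :: "'p \<Rightarrow> (real ^ 'd) set"
    and Q :: "'o measure"
    and Y :: "'p \<Rightarrow> 'y::euclidean_space set"
    and F :: "'p \<Rightarrow> 'y \<Rightarrow> real ^ 'd \<Rightarrow> 'o \<Rightarrow> 'y"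
    and ft :: "'p \<Rightarrow> real ^ 'd \<Rightarrow> 'y \<Rightarrow> 'o \<Rightarrow> real"
    and f f\<eta> :: "'p \<Rightarrow> real ^ 'd \<Rightarrow> real"
    and P :: "real ^ 'd \<Rightarrow> real"
    and B G :: "'p \<Rightarrow> real ^ 'd \<Rightarrow> real ^ 'd"
    and Pmin \<eta> c \<alpha> L :: real
    and Mb p :: "'p \<Rightarrow> real"
    and \<gamma> :: "nat \<Rightarrow> real"
    and M :: "'w measure"
    and S :: "nat \<Rightarrow> 's measure"
    and x z \<epsilon> :: "nat \<Rightarrow> 'w \<Rightarrow> real ^ 'd"
    and sel :: "nat \<Rightarrow> 'w \<Rightarrow> 'p"
    and smp :: "nat \<Rightarrow> 'w \<Rightarrow> 's"
    and Fk Fsel :: "nat \<Rightarrow> 'w measure"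
  assumes own: "surj own"
    and X: "\<And>i. X i \<subseteq> stratspace own i" "\<And>i. closed (X i)" "\<And>i. convex (X i)"
    \<comment> \<open>the hierarchical convex game\<close>
    and Q: "prob_space Q"
    and lower_mono: "\<And>i x \<omega>. x \<in> rivals_feasible own X i \<Longrightarrow> \<omega> \<in> space Q \<Longrightarrow>
          strongly_monotone_on (Y i) (\<lambda>y. F i y x \<omega>)"
    and lower_sol: "\<And>i x \<omega>. x \<in> rivals_feasible own X i \<Longrightarrow> \<omega> \<in> space Q \<Longrightarrow>
          \<exists>!y. y \<in> VI_solutions (Y i) (\<lambda>y. F i y x \<omega>)"
    and ft_int: "\<And>i x. x \<in> rivals_feasible own X i \<Longrightarrow>
          integrable Q (\<lambda>\<omega>. ft i x (lower_response Y F i x \<omega>) \<omega>)"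
    and f: "f = objective Q ft Y F"
    and f_convex: "\<And>i x. x \<in> rivals_feasible own X i \<Longrightarrow>
          convex_on (stratspace own i) (\<lambda>v. f i (repl own i v x))"
    and f_subgrad: "\<exists>C. \<forall>i. \<forall>x \<in> profiles own X. \<forall>g \<in> partial_subdiff own f i x. norm g \<le> C"
    \<comment> \<open>the smoothed game\<close>
    and \<eta>: "\<eta> > 0"
    and f\<eta>: "f\<eta> = smoothed own \<eta> f"
    and f\<eta>_convex: "\<And>i x. x \<in> rivals_feasible own X i \<Longrightarrow>
          convex_on (X i) (\<lambda>v. f\<eta> i (repl own i v x))"
    and G: "\<And>i x. x \<in> profiles own X \<Longrightarrow> GDERIV (\<lambda>v. f\<eta> i (repl own i v x)) x :> G i x"
    and L: "\<alpha> > 0" "L = \<alpha> / \<eta>"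
    and G_Lipschitz: "\<And>i x u v. x \<in> rivals_feasible own X i \<Longrightarrow> u \<in> X i \<Longrightarrow> v \<in> X i \<Longrightarrow>
          norm (G i (repl own i u x) - G i (repl own i v x)) \<le> L * norm (u - v)"
    and G_bound: "\<And>i x. x \<in> profiles own X \<Longrightarrow> norm (G i x) \<le> Mb i"
    and P: "is_potential own X f\<eta> P"
    and P_bound: "\<And>x u. x \<in> profiles own X \<Longrightarrow> u \<in> ball_product own \<Longrightarrow> P (x + \<eta> *\<^sub>R u) \<ge> Pmin"
    and c: "c > 0"
    and B: "B = prox_response own X f\<eta> c"
    \<comment> \<open>the scheme\<close>
    and M: "prob_space M"
    and p: "\<And>i. 0 < p i" "\<And>i. p i < 1" "(\<Sum>i\<in>UNIV. p i) = 1"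
    and \<gamma>: "\<And>k. 0 \<le> \<gamma> k"
    and x0: "x 0 \<in> borel_measurable M"
    and sel: "\<And>k. sel k \<in> measurable M (count_space UNIV)"
    and smp: "\<And>k. smp k \<in> measurable M (S k)"
    and Fk: "Fk = history M (x 0) sel smp S"
    and Fsel: "Fsel = history_sel M (x 0) sel smp S"
    and sel_prob: "\<And>k i. measure M {w \<in> space M. sel k w = i} = p i"
    and sel_indep: "\<And>k. prob_space.indep_set M (sets (Fk k))
          {sel k -` A \<inter> space M | A. A \<in> UNIV}"
    and x_adapted: "\<And>k. x k \<in> borel_measurable (Fk k)"
    and x_feasible: "\<And>k w. w \<in> space M \<Longrightarrow> x k w \<in> profiles own X"
    and z_feasible: "\<And>k w. w \<in> space M \<Longrightarrow> z (Suc k) w \<in> profiles own X"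
    and z_sel: "\<And>k w i. w \<in> space M \<Longrightarrow> i = sel k w \<Longrightarrow>
          block own i (z (Suc k) w) = (1 - \<gamma> k) *\<^sub>R block own i (x k w) + \<gamma> k *\<^sub>R B i (x k w)"
    and z_unsel: "\<And>k w i. w \<in> space M \<Longrightarrow> i \<noteq> sel k w \<Longrightarrow>
          block own i (z (Suc k) w) = block own i (x k w)"
    and \<epsilon>_unsel: "\<And>k w i. w \<in> space M \<Longrightarrow> i \<noteq> sel k w \<Longrightarrow> block own i (\<epsilon> (Suc k) w) = 0"
    and x_step: "\<And>k w. w \<in> space M \<Longrightarrow> x (Suc k) w = z (Suc k) w + \<epsilon> (Suc k) w"
  shows
    \<comment> \<open>(a), for the selected player \<open>i\<close>, and averaged over the selection\<close>
    "((\<forall>i k. AE w in M. sel k w = i \<longrightarrow>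
         cond_expect M (Fsel k) (\<lambda>v. P (x (Suc k) v) - Pmin) w
         \<le> ereal ((P (x k w) - Pmin)
                   - \<gamma> k * (c - L * \<gamma> k / 2) * (norm (B i (x k w) - block own i (x k w)))\<^sup>2)
           + (\<Sum>j\<in>UNIV. ereal (Mb j) *
                cond_expect M (Fsel k) (\<lambda>v. norm (block own j (\<epsilon> (Suc k) v))) w)) \<and>
      (\<forall>k. AE w in M.
         cond_expect M (Fk k) (\<lambda>v. P (x (Suc k) v) - Pmin) w
         \<le> ereal ((P (x k w) - Pmin)
                   - \<gamma> k * (c - L * \<gamma> k / 2) *
                     (\<Sum>i\<in>UNIV. p i * (norm (B i (x k w) - block own i (x k w)))\<^sup>2))
           + (\<Sum>j\<in>UNIV. ereal (Mb j) *
                cond_expect M (Fk k) (\<lambda>v. norm (block own j (\<epsilon> (Suc k) v))) w))) \<and>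
     \<comment> \<open>(b)\<close>
     (((decseq \<gamma> \<and> \<not> summable \<gamma> \<and> summable (\<lambda>k. (\<gamma> k)\<^sup>2) \<and> (\<forall>k. \<gamma> k < 2 * c / L)) \<or>
       ((\<forall>k. \<gamma> k = 1) \<and> c > L / 2)) \<and>
      (AE w in M. (\<Sum>k. \<Sum>j\<in>UNIV. ereal (Mb j) *
          cond_expect M (Fk k) (\<lambda>v. norm (block own j (\<epsilon> (Suc k) v))) w) < \<infinity>)
      \<longrightarrow> (AE w in M.
            (\<lambda>k. \<Sum>j\<in>UNIV. (norm (block own j (x k w) - B j (x k w)))\<^sup>2) \<longlonglongrightarrow> 0)) \<and>
     \<comment> \<open>(c)\<close>
     ((AE w in M. (\<lambda>k. \<Sum>j\<in>UNIV. (norm (block own j (x k w) - B j (x k w)))\<^sup>2) \<longlonglongrightarrow> 0)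
      \<longrightarrow> (AE w in M. converges_to_set (\<lambda>k. x k w) (nash_equilibria own X f\<eta>)))"
proof -
  interpret prob_space M by (rule M)
  have P_ge: "Pmin \<le> P y" if "y \<in> profiles own X" for y
  proof -
    \<comment> \<open>The lower bound on \<open>P\<close> is assumed on the enlarged set; the zero
      perturbation brings it to the feasible profiles.\<close>
    have "0 \<in> ball_product own"
      by (simp add: ball_product_def linear_0[OF bounded_linear.linear[OF bounded_linear_block]])
    from P_bound[OF \<open>y \<in> profiles own X\<close> this] show ?thesis by simp
  qed
  have sub: "subalgebra M (Fk k)" "subalgebra M (Fsel k)" for k
    unfolding Fk Fsel by (rule subalgebra_history[OF x0 sel smp] subalgebra_history_sel[OF x0 sel smp])+
  have Fk_Fsel: "sets (Fk k) \<subseteq> sets (Fsel k)" for k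
    unfolding Fk Fsel by (rule history_subset_history_sel[OF x0 sel smp])
  have Fsel_Suc: "sets (Fsel k) \<subseteq> sets (Fk (Suc k))" for k
    unfolding Fk Fsel by (rule history_sel_subset_Suc[OF x0 sel smp])
  have sel_Fsel: "sel k \<in> measurable (Fsel k) (count_space UNIV)" for k
    unfolding Fsel by (rule sel_measurable_history_sel[OF x0 sel smp])
  interpret relaxed_best_response_scheme own X f\<eta> G P L c Mb M Pmin p \<gamma> x z \<epsilon> sel Fk Fsel
    by unfold_locales
      (fact X f\<eta>_convex G G_Lipschitz G_bound P c P_ge p \<gamma> sub Fk_Fsel Fsel_Suc sel_Fsel sel_prob
        sel_indep x_adapted x_feasible z_feasible z_sel[unfolded B] z_unsel x_step)+
  have L_pos: "L > 0" using L \<eta> by simp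
  show ?thesis
  proof (intro conjI impI allI; (elim conjE)?)
    fix i k
    show "AE w in M. sel k w = i \<longrightarrow>
         cond_expect M (Fsel k) (\<lambda>v. P (x (Suc k) v) - Pmin) w
         \<le> ereal ((P (x k w) - Pmin)
                   - \<gamma> k * (c - L * \<gamma> k / 2) * (norm (B i (x k w) - block own i (x k w)))\<^sup>2)
           + (\<Sum>j\<in>UNIV. ereal (Mb j) *
                cond_expect M (Fsel k) (\<lambda>v. norm (block own j (\<epsilon> (Suc k) v))) w)"
      using cond_descent_sel[of k i] by (simp only: dec_def resid_def B)
  next
    fix k
    have "(\<Sum>i\<in>UNIV. p i * dec k i w) = \<gamma> k * (c - L * \<gamma> k / 2) *
        (\<Sum>i\<in>UNIV. p i * (norm (B i (x k w) - block own i (x k w)))\<^sup>2)" for w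
      by (simp add: dec_def resid_def B sum_distrib_left mult_ac)
    with cond_descent_avg[of k]
    show "AE w in M. cond_expect M (Fk k) (\<lambda>v. P (x (Suc k) v) - Pmin) w
         \<le> ereal ((P (x k w) - Pmin)
                   - \<gamma> k * (c - L * \<gamma> k / 2) *
                     (\<Sum>i\<in>UNIV. p i * (norm (B i (x k w) - block own i (x k w)))\<^sup>2))
           + (\<Sum>j\<in>UNIV. ereal (Mb j) *
                cond_expect M (Fk k) (\<lambda>v. norm (block own j (\<epsilon> (Suc k) v))) w)"
      by (simp only:)
  next
    assume steps: "(decseq \<gamma> \<and> \<not> summable \<gamma> \<and> summable (\<lambda>k. (\<gamma> k)\<^sup>2) \<and> (\<forall>k. \<gamma> k < 2 * c / L)) \<or>
       ((\<forall>k. \<gamma> k = 1) \<and> c > L / 2)"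
    assume "AE w in M. (\<Sum>k. \<Sum>j\<in>UNIV. ereal (Mb j) *
          cond_expect M (Fk k) (\<lambda>v. norm (block own j (\<epsilon> (Suc k) v))) w) < \<infinity>"
    then have noise: "AE w in M. summable (\<lambda>k. noise k w)"
      by (rule AE_noise_summable)
    from steps show "AE w in M.
        (\<lambda>k. \<Sum>j\<in>UNIV. (norm (block own j (x k w) - B j (x k w)))\<^sup>2) \<longlonglongrightarrow> 0"
      unfolding B
      by (elim disjE conjE) (rule AE_diminishing_steps[OF L_pos _ _ _ noise] AE_unit_steps[OF _ _ noise]; blast)+
  next
    assume "AE w in M. (\<lambda>k. \<Sum>j\<in>UNIV. (norm (block own j (x k w) - B j (x k w)))\<^sup>2) \<longlonglongrightarrow> 0"
    with AE_space show "AE w in M. converges_to_set (\<lambda>k. x k w) (nash_equilibria own X f\<eta>)"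
      unfolding B by eventually_elim (rule converges_to_nash[OF x_feasible])
  qed
qed

end
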